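(* Consider the initial value problem $y'(t)+My(t)=f(y(t))$, $y(t_0)=y_0$, with a constant $m\times m$ matrix $M$ and a sufficiently smooth $f$, and the two-stage implicit MVERK method with real coefficients $\bar a_{ij},\bar b_i$ ($i,j=1,2$), $\bar c_1=\bar a_{11}+\bar a_{12}$, $\bar c_2=\bar a_{21}+\bar a_{22}$, $$\begin{aligned}\bar Y_1&=y_0+h\big[\bar a_{11}(-M\bar Y_1+f(\bar Y_1))+\bar a_{12}(-M\bar Y_2+f(\bar Y_2))\big],\\ \bar Y_2&=y_0+h\big[\bar a_{21}(-M\bar Y_1+f(\bar Y_1))+\bar a_{22}(-M\bar Y_2+f(\bar Y_2))\big],\\ \bar y_1&=e^{-hM}y_0+h\big(\bar b_1f(\bar Y_1)+\bar b_2f(\bar Y_2)\big)+\bar w_4(z),\end{aligned}$$ where, with $g(y_0)=-My_0+f(y_0)$, $$\begin{aligned}\bar w_4(z)=&-\frac{h^2}{2!}Mf(y_0)+\frac{h^3}{3!}\Big(M^2f(y_0)-Mf'_y(y_0)g(y_0)\Big)\\&+\frac{h^4}{4!}\Big(-M^3f(y_0)+M^2f'_y(y_0)g(y_0)-Mf''_{yy}(y_0)\big(g(y_0),g(y_0)\big)-Mf'_y(y_0)(-M+f'_y(y_0))g(y_0)\Big).\end{aligned}$$ Suppose the coefficients satisfy $$\begin{aligned}&\bar b_1+\bar b_2=1,\qquad \bar b_1\bar c_1+\bar b_2\bar c_2=\tfrac12,\qquad \bar b_1\bar c_1^2+\bar b_2\bar c_2^2=\tfrac13,\\&\bar b_1(\bar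 a_{11}\bar c_1+\bar a_{12}\bar c_2)+\bar b_2(\bar a_{21}\bar c_1+\bar a_{22}\bar c_2)=\tfrac16,\qquad \bar b_1\bar c_1^3+\bar b_2\bar c_2^3=\tfrac14,\\&\bar b_1\bar c_1(\bar a_{11}\bar c_1+\bar a_{12}\bar c_2)+\bar b_2\bar c_2(\bar a_{21}\bar c_1+\bar a_{22}\bar c_2)=\tfrac18,\\&\bar b_1(\bar a_{11}\bar c_1^2+\bar a_{12}\bar c_2^2)+\bar b_2(\bar a_{21}\bar c_1^2+\bar a_{22}\bar c_2^2)=\tfrac1{12},\\&(\bar b_1\bar a_{11}+\bar b_2\bar a_{21})(\bar a_{11}\bar c_1+\bar a_{12}\bar c_2)+(\bar b_1\bar a_{12}+\bar b_2\bar a_{22})(\bar a_{21}\bar c_1+\bar a_{22}\bar c_2)=\tfrac1{24}.\end{aligned}$$ Then the method has order four.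
   Context: A one-step method has order $p$ if, for $y_0=y(t_0)$, the Taylor expansions in $h$ of the numerical solution $\bar y_1$ after one step and of the exact solution $y(t_0+h)$ coincide up to and including the $h^p$ term (so here $\bar y_1-y(t_0+h)=\mathcal O(h^5)$ as $h\to0$). This is classical (non-stiff) order: $M$ and $f$ are fixed as $h\to0$. The stages $\bar Y_1,\bar Y_2$ are the solution of the implicit equations near $y_0$ for small $h$. $f'_y(y_0)$ is the Jacobian of $f$ at $y_0$ and $f''_{yy}(y_0)(\cdot,\cdot)$ is the second derivative of $f$ at $y_0$, a symmetric bilinear map. *)

theory Defs
  imports "HOL-Analysis.Analysis" "HOL-Library.Landau_Symbols"
begin

text \<open>
  \<open>k\<close> times continuously differentiable on (an open set) \<open>U\<close>.  Asking for continuity of the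
  iterated directional derivatives is the usual notion in finite dimension.
\<close>

primrec Ck_on :: "nat \<Rightarrow> 'a set \<Rightarrow> ('a::euclidean_space \<Rightarrow> 'b::real_normed_vector) \<Rightarrow> bool" where
  "Ck_on 0 U f \<longleftrightarrow> continuous_on U f"
| "Ck_on (Suc k) U f \<longleftrightarrow>
     (\<forall>x\<in>U. f differentiable (at x)) \<and>
     (\<forall>v. Ck_on k U (\<lambda>x. frechet_derivative f (at x) v))"

text \<open>The bilinear map \<open>f''(x)(u, v)\<close>: derivative of \<open>x \<mapsto> f'(x) v\<close> in direction \<open>u\<close>.\<close>

definition second_derivative ::
    "('a::real_normed_vector \<Rightarrow> 'b::real_normed_vector) \<Rightarrow> 'a \<Rightarrow> 'a \<Rightarrow> 'a \<Rightarrow> 'b" where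
  "second_derivative f x u v =
     frechet_derivative (\<lambda>x'. frechet_derivative f (at x') v) (at x) u"

text \<open>
  On \<^typ>\<open>real^'n^'n\<close> the overloaded \<open>*\<close>, \<open>^\<close> are componentwise and \<open>exp\<close> is unavailable, so
  powers are taken with respect to \<open>**\<close>.
\<close>

definition matrix_power :: "real^'n^'n \<Rightarrow> nat \<Rightarrow> real^'n^'n" where
  "matrix_power A k = (((**) A) ^^ k) (mat 1)"

definition matrix_exp :: "real^'n^'n \<Rightarrow> real^'n^'n" where
  "matrix_exp A = (\<Sum>k. (1 / fact k) *\<^sub>R matrix_power A k)"

definition solves_ivp ::
    "(real^'n \<Rightarrow> real^'n) \<Rightarrow> real^'n^'n \<Rightarrow> (real^'n) set \<Rightarrow> real set \<Rightarrow> real \<Rightarrow> real^'n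
      \<Rightarrow> (real \<Rightarrow> real^'n) \<Rightarrow> bool" where
  "solves_ivp f M U J t0 y0 y \<longleftrightarrow>
     (\<forall>t\<in>J. y t \<in> U \<and>
        (\<exists>y'. (y has_vector_derivative y') (at t within J) \<and> y' + M *v y t = f (y t))) \<and>
     y t0 = y0"

definition mverk_w4 ::
    "real^'n^'n \<Rightarrow> (real^'n \<Rightarrow> real^'n) \<Rightarrow> real^'n \<Rightarrow> real \<Rightarrow> real^'n" where
  "mverk_w4 M f y0 h =
    (let g = - (M *v y0) + f y0;
         f' = jacobian f (at y0);
         f'' = second_derivative f y0
     in - (h^2 / fact 2) *\<^sub>R (M *v f y0)
        + (h^3 / fact 3) *\<^sub>R
            (matrix_power M 2 *v f y0 - M *v (f' *v g))
        + (h^4 / fact 4) *\<^sub>R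
            (- (matrix_power M 3 *v f y0) + matrix_power M 2 *v (f' *v g)
             - M *v f'' g g - M *v (f' *v ((- M + f') *v g))))"

text \<open>
  The stages are given as functions of the step size \<open>h\<close>.  They solve the implicit equations
  for all small admissible \<open>h\<close>; convergence to \<open>y0\<close> singles out the solution near \<open>y0\<close>.
  The filter \<open>F\<close> describes \<open>h \<rightarrow> 0\<close>.
\<close>

definition mverk_stages ::
    "real filter \<Rightarrow> real^'n^'n \<Rightarrow> (real^'n \<Rightarrow> real^'n) \<Rightarrow> real^'n
      \<Rightarrow> real \<Rightarrow> real \<Rightarrow> real \<Rightarrow> real \<Rightarrow> (real \<Rightarrow> real^'n) \<Rightarrow> (real \<Rightarrow> real^'n) \<Rightarrow> bool" where
  "mverk_stages F M f y0 a11 a12 a21 a22 Y1 Y2 \<longleftrightarrow>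
     (\<forall>\<^sub>F h in F.
        Y1 h = y0 + h *\<^sub>R (a11 *\<^sub>R (- (M *v Y1 h) + f (Y1 h)) + a12 *\<^sub>R (- (M *v Y2 h) + f (Y2 h))) \<and>
        Y2 h = y0 + h *\<^sub>R (a21 *\<^sub>R (- (M *v Y1 h) + f (Y1 h)) + a22 *\<^sub>R (- (M *v Y2 h) + f (Y2 h)))) \<and>
     (Y1 \<longlongrightarrow> y0) F \<and> (Y2 \<longlongrightarrow> y0) F"

definition mverk_update ::
    "real^'n^'n \<Rightarrow> (real^'n \<Rightarrow> real^'n) \<Rightarrow> real^'n \<Rightarrow> real \<Rightarrow> real
      \<Rightarrow> (real \<Rightarrow> real^'n) \<Rightarrow> (real \<Rightarrow> real^'n) \<Rightarrow> real \<Rightarrow> real^'n" where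
  "mverk_update M f y0 b1 b2 Y1 Y2 h =
     matrix_exp (- (h *\<^sub>R M)) *v y0 + h *\<^sub>R (b1 *\<^sub>R f (Y1 h) + b2 *\<^sub>R f (Y2 h)) + mverk_w4 M f y0 h"

text \<open>Admissible step sizes are those for which the exact solution is defined at \<open>t0 + h\<close>.\<close>

definition step_filter :: "real \<Rightarrow> real set \<Rightarrow> real filter" where
  "step_filter t0 J = at 0 within {h. t0 + h \<in> J}"

text \<open>
  The Taylor expansions of the numerical solution \<open>u h\<close> and of \<open>y (t0 + h)\<close> exist and share
  the coefficients up to \<open>h ^ p\<close>.
\<close>

definition has_order :: "nat \<Rightarrow> real filter \<Rightarrow> real \<Rightarrow> (real \<Rightarrow> 'a::real_normed_vector) \<Rightarrow> (real \<Rightarrow> 'a) \<Rightarrow> bool" where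
  "has_order p F t0 u y \<longleftrightarrow>
     (\<exists>c. (\<lambda>h. norm (u h - (\<Sum>k\<le>p. h ^ k *\<^sub>R c k))) \<in> O[F](\<lambda>h. h ^ (p + 1)) \<and>
          (\<lambda>h. norm (y (t0 + h) - (\<Sum>k\<le>p. h ^ k *\<^sub>R c k))) \<in> O[F](\<lambda>h. h ^ (p + 1)))"

lemma has_order_imp_local_error:
  assumes "has_order p F t0 u y"
  shows "(\<lambda>h. norm (u h - y (t0 + h))) \<in> O[F](\<lambda>h. h ^ (p + 1))"
proof -
  obtain c where c:
    "(\<lambda>h. norm (u h - (\<Sum>k\<le>p. h ^ k *\<^sub>R c k))) \<in> O[F](\<lambda>h. h ^ (p + 1))"
    "(\<lambda>h. norm (y (t0 + h) - (\<Sum>k\<le>p. h ^ k *\<^sub>R c k))) \<in> O[F](\<lambda>h. h ^ (p + 1))"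
    using assms unfolding has_order_def by blast
  have "norm (u h - y (t0 + h)) \<le>
      norm (u h - (\<Sum>k\<le>p. h ^ k *\<^sub>R c k)) + norm (y (t0 + h) - (\<Sum>k\<le>p. h ^ k *\<^sub>R c k))" for h
    by (metis norm_triangle_ineq4 diff_diff_eq2 diff_add_cancel)
  then have le: "(\<lambda>h. norm (u h - y (t0 + h))) \<in> O[F](\<lambda>h.
      norm (u h - (\<Sum>k\<le>p. h ^ k *\<^sub>R c k)) + norm (y (t0 + h) - (\<Sum>k\<le>p. h ^ k *\<^sub>R c k)))"
    by (intro bigoI[of _ 1]) auto
  show ?thesis
    by (rule landau_o.big_trans[OF le sum_in_bigo(1)[OF c]])
qed

end

theory Submission imports Defs begin

text \<open>
  Write \<open>g v = - M v + f v\<close>, so that the equation reads \<open>y' = g y\<close> and the stages are those of the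
  Runge--Kutta method with the same coefficients.  From a third order Taylor formula for \<open>g\<close> with
  remainder \<open>O(|d|^4)\<close>, an expansion of \<open>d h\<close> up to \<open>O(h^n)\<close> gives one of \<open>g (y0 + d h)\<close> up to
  \<open>O(h^n)\<close>; integrating (exact solution) or multiplying by \<open>h\<close> (stages) raises the order by one.
  Iterating this bootstrap yields both expansions, and the order conditions say that
  \<open>y0 + h (b1 g(Y1) + b2 g(Y2))\<close> matches \<open>y (t0 + h)\<close> up to \<open>O(h^5)\<close>.
  Since \<open>f = g + M\<close>, the remaining terms are
  \<open>exp (- h M) y0 + h M (b1 Y1 + b2 Y2) + w4 h\<close>, and \<open>w4\<close> is exactly what makes them equal to
  \<open>y0 + O(h^5)\<close>.
\<close>

subsection \<open>Taylor expansion of a \<open>C\<^sup>4\<close> function\<close>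

lemma Ck_on_Suc_D:
  assumes "Ck_on (Suc k) U f"
  shows "x \<in> U \<Longrightarrow> f differentiable (at x)"
    and "Ck_on k U (\<lambda>x. frechet_derivative f (at x) v)"
  using assms by auto

text \<open>By uniqueness of the Frechet derivative, differentiating in the base point preserves
  linearity in the parameter. Linearity is known only on \<open>U\<close>, so the sum and scaling
  rules are transferred through an open neighbourhood of \<open>x\<close>. This carries
  multilinearity from one derivative order to the next.\<close>

lemma linear_frechet_derivative_param:
  fixes \<Phi> :: "'c::real_vector \<Rightarrow> 'a::real_normed_vector \<Rightarrow> 'b::real_normed_vector"
  assumes "open U" "x \<in> U"
    and diff: "\<And>v. \<Phi> v differentiable (at x)"
    and lin: "\<And>z. z \<in> U \<Longrightarrow> linear (\<lambda>v. \<Phi> v z)"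
  shows "linear (\<lambda>v. frechet_derivative (\<Phi> v) (at x) u)"
proof (rule linearI)
  have D: "(\<Phi> v has_derivative frechet_derivative (\<Phi> v) (at x)) (at x)" for v
    using diff frechet_derivative_works by blast
  fix v w :: 'c and r :: real
  have "(\<Phi> (v + w) has_derivative
      (\<lambda>u. frechet_derivative (\<Phi> v) (at x) u + frechet_derivative (\<Phi> w) (at x) u)) (at x)"
    by (rule has_derivative_transform_within_open[OF has_derivative_add[OF D D] assms(1,2)])
      (simp add: linear_add[OF lin])
  then show "frechet_derivative (\<Phi> (v + w)) (at x) u =
      frechet_derivative (\<Phi> v) (at x) u + frechet_derivative (\<Phi> w) (at x) u"
    using frechet_derivative_at by metis
  have "(\<Phi> (r *\<^sub>R v) has_derivative (\<lambda>u. r *\<^sub>R frechet_derivative (\<Phi> v) (at x) u)) (at x)"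
    by (rule has_derivative_transform_within_open[OF has_derivative_scaleR_right[OF D] assms(1,2)])
      (simp add: linear_scale[OF lin])
  then show "frechet_derivative (\<Phi> (r *\<^sub>R v)) (at x) u = r *\<^sub>R frechet_derivative (\<Phi> v) (at x) u"
    using frechet_derivative_at by metis
qed

text \<open>Expanding \<open>v\<close> in \<open>Basis\<close> reduces the bound to finitely many
  vectors, so a single constant serves all parameters \<open>p\<close>. The weight
  \<open>N p\<close> is meant to hold the norms of slots treated earlier: multilinear bounds then
  arise by freeing one slot at a time.\<close>

lemma linear_family_bound:
  fixes \<Psi> :: "'p \<Rightarrow> 'a::euclidean_space \<Rightarrow> 'b::real_normed_vector"
  assumes lin: "\<And>p. p \<in> P \<Longrightarrow> linear (\<Psi> p)"
    and bnd: "\<And>b. b \<in> Basis \<Longrightarrow> \<exists>K. \<forall>p\<in>P. norm (\<Psi> p b) \<le> K * N p"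
  shows "\<exists>K. \<forall>p\<in>P. \<forall>v. norm (\<Psi> p v) \<le> K * N p * norm v"
proof -
  obtain K where K: "\<And>b p. b \<in> Basis \<Longrightarrow> p \<in> P \<Longrightarrow> norm (\<Psi> p b) \<le> K b * N p"
    using bnd by metis
  have "norm (\<Psi> p v) \<le> (\<Sum>b\<in>Basis. K b) * N p * norm v" if p: "p \<in> P" for p v
  proof -
    have "\<Psi> p v = \<Psi> p (\<Sum>b\<in>Basis. (v \<bullet> b) *\<^sub>R b)"
      by (simp add: euclidean_representation)
    also have "\<dots> = (\<Sum>b\<in>Basis. (v \<bullet> b) *\<^sub>R \<Psi> p b)"
      by (simp add: linear_sum[OF lin[OF p]] linear_scale[OF lin[OF p]])
    also have "norm \<dots> \<le> (\<Sum>b\<in>Basis. K b * N p * norm v)"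
    proof (rule sum_norm_le)
      fix b :: 'a assume b: "b \<in> Basis"
      have "norm ((v \<bullet> b) *\<^sub>R \<Psi> p b) = \<bar>v \<bullet> b\<bar> * norm (\<Psi> p b)" by simp
      also have "\<dots> \<le> norm v * (K b * N p)"
        by (intro mult_mono Basis_le_norm K b p) auto
      finally show "norm ((v \<bullet> b) *\<^sub>R \<Psi> p b) \<le> K b * N p * norm v" by (simp add: mult_ac)
    qed
    finally show ?thesis by (simp add: sum_distrib_right)
  qed
  then show ?thesis by blast
qed

section \<open>Multilinearity and bounds of the derivatives up to order four\<close>

definition third_derivative ::
    "('a::real_normed_vector \<Rightarrow> 'b::real_normed_vector) \<Rightarrow> 'a \<Rightarrow> 'a \<Rightarrow> 'a \<Rightarrow> 'a \<Rightarrow> 'b" where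
  "third_derivative f x u v w = frechet_derivative (\<lambda>x'. second_derivative f x' v w) (at x) u"

definition fourth_derivative ::
    "('a::real_normed_vector \<Rightarrow> 'b::real_normed_vector) \<Rightarrow> 'a \<Rightarrow> 'a \<Rightarrow> 'a \<Rightarrow> 'a \<Rightarrow> 'a \<Rightarrow> 'b" where
  "fourth_derivative f x u v w z = frechet_derivative (\<lambda>x'. third_derivative f x' v w z) (at x) u"

context
  fixes f :: "'a::euclidean_space \<Rightarrow> 'b::real_normed_vector" and U :: "'a set"
  assumes U: "open U" and C4: "Ck_on 4 U f"
begin

lemma Ck_on_iterated_derivatives:
  "Ck_on 3 U (\<lambda>x. frechet_derivative f (at x) w)"
  "Ck_on 2 U (\<lambda>x. second_derivative f x v w)"
  "Ck_on 1 U (\<lambda>x. third_derivative f x u v w)"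
  "Ck_on 0 U (\<lambda>x. fourth_derivative f x z u v w)"
proof -
  show 3: "Ck_on 3 U (\<lambda>x. frechet_derivative f (at x) w)" for w
    using C4 Ck_on_Suc_D(2)[of 3] by simp
  show 2: "Ck_on 2 U (\<lambda>x. second_derivative f x v w)" for v w
    unfolding second_derivative_def
    using Ck_on_Suc_D(2)[of 2, OF 3[simplified numeral_3_eq_3, folded numeral_2_eq_2]] by simp
  show 1: "Ck_on 1 U (\<lambda>x. third_derivative f x u v w)" for u v w
    unfolding third_derivative_def
    using Ck_on_Suc_D(2)[of 1, OF 2[simplified numeral_2_eq_2, folded One_nat_def]] by simp
  show "Ck_on 0 U (\<lambda>x. fourth_derivative f x z u v w)"
    unfolding fourth_derivative_def
    using Ck_on_Suc_D(2)[of 0, OF 1[unfolded One_nat_def]] .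
qed

lemma differentiable_iterated_derivatives:
  assumes "x \<in> U"
  shows "f differentiable (at x)"
    and "(\<lambda>x. frechet_derivative f (at x) w) differentiable (at x)"
    and "(\<lambda>x. second_derivative f x v w) differentiable (at x)"
    and "(\<lambda>x. third_derivative f x u v w) differentiable (at x)"
proof -
  show "f differentiable (at x)"
    by (rule Ck_on_Suc_D(1)[of 3 U]) (use C4 assms in simp_all)
  show "(\<lambda>x. frechet_derivative f (at x) w) differentiable (at x)"
    by (rule Ck_on_Suc_D(1)[of 2 U]) (use Ck_on_iterated_derivatives(1) assms in simp_all)
  show "(\<lambda>x. second_derivative f x v w) differentiable (at x)"
    by (rule Ck_on_Suc_D(1)[of 1 U], unfold Suc_1) (use Ck_on_iterated_derivatives(2) assms in auto)
  show "(\<lambda>x. third_derivative f x u v w) differentiable (at x)"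
    by (rule Ck_on_Suc_D(1)[of 0 U], fold One_nat_def) (use Ck_on_iterated_derivatives(3) assms in auto)
qed

text \<open>The first slot is the newest direction, in which a Frechet derivative is linear. Every
  older slot inherits linearity from the preceding order through
  \<open>linear_frechet_derivative_param\<close>.\<close>

lemma linear_iterated_derivatives:
  "x \<in> U \<Longrightarrow> linear (frechet_derivative f (at x))"
  "x \<in> U \<Longrightarrow> linear (\<lambda>u. second_derivative f x u v)"
  "x \<in> U \<Longrightarrow> linear (second_derivative f x u)"
  "x \<in> U \<Longrightarrow> linear (\<lambda>u. third_derivative f x u v w)"
  "x \<in> U \<Longrightarrow> linear (\<lambda>v. third_derivative f x u v w)"
  "x \<in> U \<Longrightarrow> linear (third_derivative f x u v)"
  "x \<in> U \<Longrightarrow> linear (\<lambda>u. fourth_derivative f x u v w z)"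
  "x \<in> U \<Longrightarrow> linear (\<lambda>v. fourth_derivative f x u v w z)"
  "x \<in> U \<Longrightarrow> linear (\<lambda>w. fourth_derivative f x u v w z)"
  "x \<in> U \<Longrightarrow> linear (fourth_derivative f x u v w)"
proof -
  note d = differentiable_iterated_derivatives
  note lp = linear_frechet_derivative_param[OF U]
  show 1: "linear (frechet_derivative f (at x))" if "x \<in> U" for x
    using that by (intro linear_frechet_derivative d)
  show 2: "linear (\<lambda>u. second_derivative f x u v)" if "x \<in> U" for x v
    unfolding second_derivative_def using that by (intro linear_frechet_derivative d)
  show t2a: "linear (second_derivative f x u)" if "x \<in> U" for x u
    unfolding second_derivative_def using that by (intro lp d 1)
  show 3: "linear (\<lambda>u. third_derivative f x u v w)" if "x \<in> U" for x v w
    unfolding third_derivative_def using that by (intro linear_frechet_derivative d)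
  show t3a: "linear (\<lambda>v. third_derivative f x u v w)" if "x \<in> U" for x u w
    unfolding third_derivative_def using that by (intro lp d 2)
  show t3b: "linear (third_derivative f x u v)" if "x \<in> U" for x u v
    unfolding third_derivative_def using that by (intro lp d t2a)
  show "linear (\<lambda>u. fourth_derivative f x u v w z)" if "x \<in> U" for x v w z
    unfolding fourth_derivative_def using that by (intro linear_frechet_derivative d)
  show "linear (\<lambda>v. fourth_derivative f x u v w z)" if "x \<in> U" for x u w z
    unfolding fourth_derivative_def using that by (intro lp d 3)
  show "linear (\<lambda>w. fourth_derivative f x u v w z)" if "x \<in> U" for x u v z
    unfolding fourth_derivative_def using that by (intro lp d t3a)
  show "linear (fourth_derivative f x u v w)" if "x \<in> U" for x u v w
    unfolding fourth_derivative_def using that by (intro lp d t3b)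
qed

text \<open>The slots are freed in the order \<open>w\<close>, \<open>v\<close>, \<open>u\<close>.
  At each stage the slots still to come are fixed and those already freed belong to the parameter of
  \<open>linear_family_bound\<close>.\<close>

lemma third_derivative_bound:
  assumes "x \<in> U"
  shows "\<exists>K. \<forall>u v w. norm (third_derivative f x u v w) \<le> K * norm u * norm v * norm w"
proof -
  have 1: "\<exists>K. \<forall>p\<in>UNIV. \<forall>w. norm (third_derivative f x (u::'a) v w) \<le> K * (1::real) * norm w" for u v
    by (rule linear_family_bound) (auto simp: linear_iterated_derivatives[OF assms] intro: order_refl)
  have 2: "\<exists>K. \<forall>p\<in>UNIV. \<forall>v. norm (third_derivative f x u v p) \<le> K * norm p * norm v" for u
    using 1 by (intro linear_family_bound) (auto simp: linear_iterated_derivatives[OF assms])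
  have 3: "\<exists>K. \<forall>p\<in>UNIV. norm (third_derivative f x u (fst p) (snd p)) \<le>
      K * (norm (fst p) * norm (snd p))" for u
  proof -
    obtain K where "\<And>v w. norm (third_derivative f x u v w) \<le> K * norm w * norm v"
      using 2[of u] by auto
    then show ?thesis by (auto simp: mult.assoc mult.commute[of "norm (fst _)"])
  qed
  have "\<exists>K. \<forall>p\<in>UNIV. \<forall>u. norm (third_derivative f x u (fst p) (snd p)) \<le>
      K * (norm (fst p) * norm (snd p)) * norm u"
    using 3 by (intro linear_family_bound) (auto simp: linear_iterated_derivatives[OF assms])
  then obtain K where "\<And>u v w. norm (third_derivative f x u v w) \<le> K * (norm v * norm w) * norm u"
    by auto
  then show ?thesis by (intro exI[of _ K]) (simp add: mult_ac)
qed

text \<open>\<open>Ck_on\<close> gives continuity in the base point for fixed directions only, hence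
  boundedness on the compact set \<open>S\<close> for each choice of directions. Keeping the base
  point in the parameter while the slots are freed one by one makes the constant uniform over
  \<open>S\<close>.\<close>

lemma fourth_derivative_bound:
  assumes "S \<subseteq> U" "compact S"
  shows "\<exists>K. \<forall>x\<in>S. \<forall>d. norm (fourth_derivative f x d d d d) \<le> K * norm d ^ 4"
proof -
  let ?D = "fourth_derivative f"
  have sub: "x \<in> S \<Longrightarrow> x \<in> U" for x using assms by auto
  have 0: "\<exists>K. \<forall>x\<in>S. norm (?D x z u v w) \<le> K" for z u v w
  proof -
    have "compact ((\<lambda>x. ?D x z u v w) ` S)"
      using Ck_on_iterated_derivatives(4)[of z u v w, unfolded Ck_on.simps] assms
      by (intro compact_continuous_image) (auto intro: continuous_on_subset)
    then show ?thesis using compact_imp_bounded bounded_iff by (metis image_eqI)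
  qed
  have 1: "\<exists>K. \<forall>x\<in>S. \<forall>w. norm (?D x z u v w) \<le> K * (1::real) * norm w" for z u v
    by (rule linear_family_bound) (auto simp: linear_iterated_derivatives sub 0)
  have 2: "\<exists>K. \<forall>p\<in>S\<times>UNIV. \<forall>v. norm (?D (fst p) z u v (snd p)) \<le> K * norm (snd p) * norm v" for z u
    using 1 by (intro linear_family_bound) (auto simp: linear_iterated_derivatives sub)
  have 3: "\<exists>K. \<forall>p\<in>S\<times>UNIV\<times>UNIV. \<forall>u. norm (?D (fst p) z u (fst (snd p)) (snd (snd p)))
      \<le> K * (norm (fst (snd p)) * norm (snd (snd p))) * norm u" for z
  proof (intro linear_family_bound)
    fix b :: 'a
    obtain K where "\<And>x v w. x \<in> S \<Longrightarrow> norm (?D x z b v w) \<le> K * norm w * norm v"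
      using 2[of z b] by auto
    then show "\<exists>K. \<forall>p\<in>S\<times>UNIV\<times>UNIV. norm (?D (fst p) z b (fst (snd p)) (snd (snd p)))
      \<le> K * (norm (fst (snd p)) * norm (snd (snd p)))"
      by (auto simp: mult.assoc mult.commute[of "norm (fst (snd _))"])
  qed (auto simp: linear_iterated_derivatives sub)
  have "\<exists>K. \<forall>p\<in>S\<times>UNIV\<times>UNIV\<times>UNIV. \<forall>z.
       norm (?D (fst p) z (fst (snd p)) (fst (snd (snd p))) (snd (snd (snd p))))
      \<le> K * (norm (fst (snd p)) * norm (fst (snd (snd p))) * norm (snd (snd (snd p)))) * norm z"
  proof (intro linear_family_bound)
    fix b :: 'a
    obtain K where K: "\<forall>p\<in>S\<times>UNIV\<times>UNIV. \<forall>u. norm (?D (fst p) b u (fst (snd p)) (snd (snd p)))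
      \<le> K * (norm (fst (snd p)) * norm (snd (snd p))) * norm u"
      using 3[of b] by blast
    have *: "norm (?D x b u v w) \<le> K * (norm v * norm w) * norm u" if "x \<in> S" for x u v w
    proof -
      have "(x, v, w) \<in> S \<times> UNIV \<times> UNIV" using that by blast
      from bspec[OF K this] show ?thesis by (simp only: fst_conv snd_conv)
    qed
    show "\<exists>K. \<forall>p\<in>S\<times>UNIV\<times>UNIV\<times>UNIV.
       norm (?D (fst p) b (fst (snd p)) (fst (snd (snd p))) (snd (snd (snd p))))
      \<le> K * (norm (fst (snd p)) * norm (fst (snd (snd p))) * norm (snd (snd (snd p))))"
    proof (intro exI ballI)
      fix p :: "'a \<times> 'a \<times> 'a \<times> 'a" assume "p \<in> S \<times> UNIV \<times> UNIV \<times> UNIV"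
      then have "fst p \<in> S" by auto
      from *[OF this] show "norm (?D (fst p) b (fst (snd p)) (fst (snd (snd p))) (snd (snd (snd p))))
          \<le> K * (norm (fst (snd p)) * norm (fst (snd (snd p))) * norm (snd (snd (snd p))))"
        by (simp only: mult_ac)
    qed
  qed (auto simp: linear_iterated_derivatives sub)
  then obtain K where "\<And>x d. x \<in> S \<Longrightarrow> norm (?D x d d d d) \<le> K * (norm d * norm d * norm d) * norm d"
    by fastforce
  then show ?thesis by (auto simp: eval_nat_numeral mult_ac intro!: exI[of _ K])
qed

end

text \<open>Along the segment from \<open>x\<close> to \<open>x + d\<close> this is the one-variable
  Taylor formula with integral remainder. A closed ball inside \<open>U\<close> is compact, so the
  bound on the fourth derivative, and with it \<open>K\<close>, does not depend on
  \<open>d\<close>.\<close>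

lemma Ck_on_4_Taylor:
  fixes f :: "'a::euclidean_space \<Rightarrow> 'b::banach"
  assumes U: "open U" "x \<in> U" and C4: "Ck_on 4 U f"
  obtains K r where "r > 0"
    "\<And>d. norm d < r \<Longrightarrow> norm (f (x + d) - (f x + frechet_derivative f (at x) d
       + (1/2) *\<^sub>R second_derivative f x d d + (1/6) *\<^sub>R third_derivative f x d d d)) \<le> K * norm d ^ 4"
proof -
  obtain r where r: "r > 0" "cball x r \<subseteq> U"
    using U open_contains_cball by blast
  obtain K where K: "\<And>z d. z \<in> cball x r \<Longrightarrow> norm (fourth_derivative f z d d d d) \<le> K * norm d ^ 4"
    using fourth_derivative_bound[OF U(1) C4 r(2) compact_cball] by blast
  have "norm (f (x + d) - (f x + frechet_derivative f (at x) d
       + (1/2) *\<^sub>R second_derivative f x d d + (1/6) *\<^sub>R third_derivative f x d d d)) \<le> K * norm d ^ 4"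
    if d: "norm d < r" for d
  proof -
    \<comment> \<open>\<open>Df m\<close> is the \<open>m\<close>-th derivative of the restriction
      of \<open>f\<close> to the segment; the last branch serves \<open>m = 4\<close>.\<close>
    define Df where "Df m = (\<lambda>s. let z = x + s *\<^sub>R d in
        if m = 0 then f z else if m = 1 then frechet_derivative f (at z) d
        else if m = 2 then second_derivative f z d d else if m = 3 then third_derivative f z d d d
        else fourth_derivative f z d d d d)" for m :: nat
    have Df: "Df 0 = (\<lambda>s. f (x + s *\<^sub>R d))"
      "Df (Suc 0) = (\<lambda>s. frechet_derivative f (at (x + s *\<^sub>R d)) d)"
      "Df 1 = (\<lambda>s. frechet_derivative f (at (x + s *\<^sub>R d)) d)"
      "Df (Suc 1) = (\<lambda>s. second_derivative f (x + s *\<^sub>R d) d d)"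
      "Df 2 = (\<lambda>s. second_derivative f (x + s *\<^sub>R d) d d)"
      "Df (Suc 2) = (\<lambda>s. third_derivative f (x + s *\<^sub>R d) d d d)"
      "Df 3 = (\<lambda>s. third_derivative f (x + s *\<^sub>R d) d d d)"
      "Df (Suc 3) = (\<lambda>s. fourth_derivative f (x + s *\<^sub>R d) d d d d)"
      "Df 4 = (\<lambda>s. fourth_derivative f (x + s *\<^sub>R d) d d d d)"
      by (simp_all add: Df_def Let_def)
    have seg: "x + s *\<^sub>R d \<in> cball x r" if "0 \<le> s" "s \<le> 1" for s
    proof -
      have "\<bar>s\<bar> * norm d \<le> 1 * norm d" by (rule mult_right_mono) (use that in auto)
      then show ?thesis using d by (simp add: dist_norm)
    qed
    have line: "((\<lambda>s. \<phi> (x + s *\<^sub>R d)) has_vector_derivative frechet_derivative \<phi> (at (x + s *\<^sub>R d)) d)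
        (at s within {0..1})"
      if "\<phi> differentiable (at (x + s *\<^sub>R d))" for \<phi> :: "'a \<Rightarrow> 'b" and s
    proof -
      have "((\<lambda>s. x + s *\<^sub>R d) has_derivative (\<lambda>t. t *\<^sub>R d)) (at s within {0..1})"
        by (auto intro!: derivative_eq_intros)
      moreover have "(\<phi> has_derivative frechet_derivative \<phi> (at (x + s *\<^sub>R d))) (at (x + s *\<^sub>R d))"
        using that frechet_derivative_works by blast
      ultimately have "((\<lambda>s. \<phi> (x + s *\<^sub>R d)) has_derivative
          (\<lambda>t. frechet_derivative \<phi> (at (x + s *\<^sub>R d)) (t *\<^sub>R d))) (at s within {0..1})"
        by (rule has_derivative_compose)
      then show ?thesis
        unfolding has_vector_derivative_def
        by (simp add: linear_scale[OF linear_frechet_derivative[OF that]])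
    qed
    have "(Df m has_vector_derivative Df (Suc m) s) (at s within {0..1})"
      if "m < 4" "0 \<le> s" "s \<le> 1" for m s
    proof -
      have z: "x + s *\<^sub>R d \<in> U" using seg that r by auto
      note dc = differentiable_iterated_derivatives[OF U(1) C4 z]
      have "m = 0 \<or> m = 1 \<or> m = 2 \<or> m = 3" using \<open>m < 4\<close> by linarith
      then show ?thesis
        using line[OF dc(1)] line[OF dc(2), of d, folded second_derivative_def]
          line[OF dc(3), of d d, folded third_derivative_def]
          line[OF dc(4), of d d d, folded fourth_derivative_def]
        by (elim disjE) (simp_all only: Df)
    qed
    from Taylor_has_integral[of 4 Df "Df 0" 0 1, OF _ refl this]
    have "((\<lambda>s. ((1 - s) ^ 3 / fact 3) *\<^sub>R Df 4 s) has_integral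
        Df 0 1 - (\<Sum>i<4. (1 / fact i) *\<^sub>R Df i 0)) (cbox 0 1)"
      by simp
    moreover have "norm (((1 - s) ^ 3 / fact 3) *\<^sub>R Df 4 s) \<le> K * norm d ^ 4"
      if "s \<in> cbox 0 1" for s
    proof -
      have "\<bar>(1 - s) ^ 3 / fact 3\<bar> \<le> 1"
        using that power_le_one[of "1 - s" 3] by (simp add: fact_numeral)
      then have "\<bar>(1 - s) ^ 3 / fact 3\<bar> * norm (Df 4 s) \<le> 1 * norm (Df 4 s)"
        by (rule mult_right_mono) simp
      also have "\<dots> \<le> K * norm d ^ 4"
        using K[OF seg, of s d] that by (simp add: Df)
      finally show ?thesis by simp
    qed
    \<comment> \<open>The integral estimate asks for a nonnegative bound, while the sign of
      \<open>K\<close> is unknown. The derivative bound at the centre \<open>x\<close> settles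
      it.\<close>
    moreover have "0 \<le> K * norm d ^ 4"
      using norm_ge_zero K[of x d] r by (meson centre_in_cball less_imp_le order_trans)
    ultimately have "norm (Df 0 1 - (\<Sum>i<4. (1 / fact i) *\<^sub>R Df i 0)) \<le> K * norm d ^ 4 * measure lborel (cbox 0 (1::real))"
      using has_integral_bound[of "K * norm d ^ 4"] by blast
    then show ?thesis
      by (simp add: lessThan_nat_numeral fact_numeral Df[unfolded One_nat_def] algebra_simps)
  qed
  then show ?thesis using that r by blast
qed

subsection \<open>Vector-valued Landau symbols at a step-size filter\<close>

text \<open>Landau symbols compare scalar functions, hence the norm. The filter is a parameter so
  that one-sided steps, at an endpoint of the time interval, are covered as well.\<close>

definition vec_bigo :: "real filter \<Rightarrow> nat \<Rightarrow> (real \<Rightarrow> 'a::real_normed_vector) \<Rightarrow> bool" where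
  "vec_bigo F n d \<longleftrightarrow> (\<lambda>h. norm (d h)) \<in> O[F](\<lambda>h. h ^ n)"

lemma vec_bigoI:
  assumes "\<forall>\<^sub>F h in F. norm (d h) \<le> K * \<bar>h\<bar> ^ n"
  shows "vec_bigo F n d"
  unfolding vec_bigo_def by (rule bigoI[of _ K]) (use assms in \<open>simp add: power_abs\<close>)

lemma vec_bigoE:
  assumes "vec_bigo F n d"
  obtains K where "K > 0" "\<forall>\<^sub>F h in F. norm (d h) \<le> K * \<bar>h\<bar> ^ n"
  using assms unfolding vec_bigo_def by (elim landau_o.bigE) (auto simp: power_abs)

lemma vec_bigo_cong:
  assumes "\<forall>\<^sub>F h in F. d h = e h" "vec_bigo F n e"
  shows "vec_bigo F n d"
  using assms(2)
proof (rule vec_bigoE)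
  fix K assume "\<forall>\<^sub>F h in F. norm (e h) \<le> K * \<bar>h\<bar> ^ n"
  with assms(1) show ?thesis
    by (intro vec_bigoI[where K = K]) (auto elim: eventually_elim2)
qed

lemma vec_bigo_norm_le:
  assumes "vec_bigo F n e" "\<forall>\<^sub>F h in F. norm (d h) \<le> C * norm (e h)"
  shows "vec_bigo F n d"
  using assms(1)
proof (rule vec_bigoE)
  fix K assume "\<forall>\<^sub>F h in F. norm (e h) \<le> K * \<bar>h\<bar> ^ n"
  \<comment> \<open>The sign of \<open>C\<close> is unknown, and the bound on
    \<open>norm (e h)\<close> may only be multiplied by a nonnegative factor.\<close>
  with assms(2) have "\<forall>\<^sub>F h in F. norm (d h) \<le> \<bar>C\<bar> * K * \<bar>h\<bar> ^ n"
  proof eventually_elim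
    case (elim h)
    have "norm (d h) \<le> \<bar>C\<bar> * norm (e h)"
      using elim(1) by (meson abs_ge_self mult_right_mono norm_ge_zero order_trans)
    also have "\<dots> \<le> \<bar>C\<bar> * (K * \<bar>h\<bar> ^ n)"
      by (intro mult_left_mono elim) auto
    finally show ?case by (simp add: mult.assoc)
  qed
  then show ?thesis by (rule vec_bigoI)
qed

lemma vec_bigo_add: "vec_bigo F n d \<Longrightarrow> vec_bigo F n e \<Longrightarrow> vec_bigo F n (\<lambda>h. d h + e h)"
proof (elim vec_bigoE)
  fix K L assume "\<forall>\<^sub>F h in F. norm (d h) \<le> K * \<bar>h\<bar> ^ n" "\<forall>\<^sub>F h in F. norm (e h) \<le> L * \<bar>h\<bar> ^ n"
  then have "\<forall>\<^sub>F h in F. norm (d h + e h) \<le> (K + L) * \<bar>h\<bar> ^ n"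
    by eventually_elim (metis add_mono distrib_right norm_triangle_le)
  then show ?thesis by (rule vec_bigoI)
qed

lemma vec_bigo_bounded_linear:
  assumes "bounded_linear A" "vec_bigo F n d"
  shows "vec_bigo F n (\<lambda>h. A (d h))"
proof -
  obtain K where "\<And>x. norm (A x) \<le> norm x * K"
    using bounded_linear.bounded[OF assms(1)] by blast
  then show ?thesis
    by (intro vec_bigo_norm_le[OF assms(2), of _ K]) (simp add: mult.commute)
qed

lemma vec_bigo_scaleR: "vec_bigo F n d \<Longrightarrow> vec_bigo F n (\<lambda>h. c *\<^sub>R d h)"
  by (rule vec_bigo_bounded_linear[OF bounded_linear_scaleR_right])

lemma vec_bigo_power_scaleR:
  assumes "vec_bigo F n d"
  shows "vec_bigo F (k + n) (\<lambda>h. h ^ k *\<^sub>R d h)"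
  using assms
proof (rule vec_bigoE)
  fix K assume "\<forall>\<^sub>F h in F. norm (d h) \<le> K * \<bar>h\<bar> ^ n"
  then have "\<forall>\<^sub>F h in F. norm (h ^ k *\<^sub>R d h) \<le> K * \<bar>h\<bar> ^ (k + n)"
    by eventually_elim (simp add: power_add power_abs mult.left_commute[of K] mult_left_mono)
  then show ?thesis by (rule vec_bigoI)
qed

lemma vec_bigo_const: "vec_bigo F 0 (\<lambda>h. c)"
  by (rule vec_bigoI[where K = "norm c"]) simp

lemma vec_bigo_mono:
  assumes F: "F \<le> at 0" and "vec_bigo F n d" "m \<le> n"
  shows "vec_bigo F m d"
  using assms(2)
proof (rule vec_bigoE)
  fix K :: real assume K: "K > 0" "\<forall>\<^sub>F h in F. norm (d h) \<le> K * \<bar>h\<bar> ^ n"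
  have "\<forall>\<^sub>F h in F. \<bar>h\<bar> < 1"
    using F by (rule filter_leD) (auto simp: eventually_at intro!: exI[of _ 1])
  with K(2) have "\<forall>\<^sub>F h in F. norm (d h) \<le> K * \<bar>h\<bar> ^ m"
  proof eventually_elim
    case (elim h)
    have "\<bar>h\<bar> ^ n \<le> \<bar>h\<bar> ^ m" using elim assms(3) by (intro power_decreasing) auto
    then show ?case using elim(1) K(1) by (meson mult_left_mono less_imp_le order_trans)
  qed
  then show ?thesis by (rule vec_bigoI)
qed

lemma vec_bigo_monomial:
  assumes "F \<le> at 0" "m \<le> k"
  shows "vec_bigo F m (\<lambda>h. h ^ k *\<^sub>R c)"
  using vec_bigo_mono[OF assms(1) vec_bigo_power_scaleR[OF vec_bigo_const, of F k c]] assms(2) by simp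

text \<open>This starts the bootstraps: convergence alone is the order 0 case.\<close>

lemma vec_bigo_tendsto:
  assumes "(d \<longlongrightarrow> l) F"
  shows "vec_bigo F 0 d"
proof -
  have "\<forall>\<^sub>F h in F. norm (d h) < norm l + 1"
    using tendsto_norm[OF assms] by (rule order_tendstoD(2)) simp
  then show ?thesis
    by (intro vec_bigoI[where K = "norm l + 1"]) (auto elim: eventually_mono)
qed

lemma vec_bigo_norm_power:
  assumes "vec_bigo F n d"
  shows "vec_bigo F (n * k) (\<lambda>h. norm (d h) ^ k)"
  using assms
proof (rule vec_bigoE)
  fix K assume "\<forall>\<^sub>F h in F. norm (d h) \<le> K * \<bar>h\<bar> ^ n"
  then have "\<forall>\<^sub>F h in F. norm (norm (d h) ^ k) \<le> K ^ k * \<bar>h\<bar> ^ (n * k)"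
  proof eventually_elim
    case (elim h)
    then have "norm (d h) ^ k \<le> (K * \<bar>h\<bar> ^ n) ^ k" by (rule power_mono) simp
    then show ?case by (simp add: power_mult power_mult_distrib)
  qed
  then show ?thesis by (rule vec_bigoI)
qed

lemma vec_bigo_mult:
  assumes "vec_bigo F m p" "vec_bigo F n q"
  shows "vec_bigo F (m + n) (\<lambda>h. norm (p h) * norm (q h))"
  using landau_o.big_mult[OF assms[unfolded vec_bigo_def]]
  by (simp add: vec_bigo_def power_add)

lemma vec_bigo_bilinear:
  assumes "bounded_bilinear B" "vec_bigo F m p" "vec_bigo F n q"
  shows "vec_bigo F (m + n) (\<lambda>h. B (p h) (q h))"
proof -
  obtain K where "\<And>u v. norm (B u v) \<le> norm u * norm v * K"
    using bounded_bilinear.bounded[OF assms(1)] by blast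
  then show ?thesis
    by (intro vec_bigo_norm_le[OF vec_bigo_mult[OF assms(2,3)], of _ K])
      (simp add: mult.commute[of K])
qed

lemma vec_bigo_trilinear:
  assumes "\<And>u v w. norm (C u v w) \<le> K * norm u * norm v * norm w"
    and "vec_bigo F l p" "vec_bigo F m q" "vec_bigo F n r"
  shows "vec_bigo F (l + m + n) (\<lambda>h. C (p h) (q h) (r h))"
  by (rule vec_bigo_norm_le[OF vec_bigo_mult[OF vec_bigo_mult[OF assms(2,3)] assms(4)], of _ K])
    (use assms(1) in \<open>simp add: mult.assoc\<close>)

subsection \<open>Expansions of the exact solution and of the stages\<close>

text \<open>Write \<open>d = p + e\<close> with \<open>p\<close> the cubic polynomial and
  \<open>e\<close> of order \<open>n\<close>. Replacing \<open>d\<close> by \<open>p\<close> in the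
  multilinear terms changes one slot at a time and costs O(h^n). Expanding these terms at
  \<open>p\<close> then drops only O(h^4), which is absorbed because
  \<open>n \<le> 4\<close>.\<close>

lemma vec_bigo_compose_Taylor:
  fixes B :: "'a::real_normed_vector \<Rightarrow> 'a \<Rightarrow> 'b::real_normed_vector"
  assumes F: "F \<le> at 0"
    and A: "bounded_linear A" and B: "bounded_bilinear B"
    and C: "\<And>v w. linear (\<lambda>u. C u v w)" "\<And>u w. linear (\<lambda>v. C u v w)" "\<And>u v. linear (C u v)"
      "\<And>u v w. norm (C u v w) \<le> K * norm u * norm v * norm w"
    and T: "r > 0" "\<And>d. norm d < r \<Longrightarrow> norm (f (x + d) - (f x + A d + B d d + C d d d)) \<le> L * norm d ^ 4"
    and d: "(d \<longlongrightarrow> 0) F"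
    and P: "vec_bigo F n (\<lambda>h. d h - (h *\<^sub>R u1 + h^2 *\<^sub>R u2 + h^3 *\<^sub>R u3))"
    and n: "n \<le> 4"
  shows "vec_bigo F n (\<lambda>h. f (x + d h) - (f x + h *\<^sub>R A u1 + h^2 *\<^sub>R (A u2 + B u1 u1)
     + h^3 *\<^sub>R (A u3 + B u1 u2 + B u2 u1 + C u1 u1 u1)))"
proof -
  interpret A: bounded_linear A by fact
  interpret B: bounded_bilinear B by fact
  define p where "p h = h *\<^sub>R u1 + h^2 *\<^sub>R u2 + h^3 *\<^sub>R u3" for h :: real
  define e where "e h = d h - p h" for h
  have mono: "vec_bigo F m q" if "vec_bigo F k q" "m \<le> k" for m k and q :: "real \<Rightarrow> 'c::real_normed_vector"
    using vec_bigo_mono[OF F] that .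
  have mon: "vec_bigo F m (\<lambda>h. h ^ k *\<^sub>R c)" if "m \<le> k" for m k and c :: 'a
    by (rule vec_bigo_monomial[OF F that])
  have e: "vec_bigo F n e" using P by (simp add: e_def[abs_def] p_def)
  have p1: "vec_bigo F 1 p"
    unfolding p_def[abs_def] using mon[of 1 1 u1]
    by (intro vec_bigo_add mon) auto
  then have p0: "vec_bigo F 0 p" by (rule mono) simp
  have p2: "vec_bigo F 2 (\<lambda>h. p h - h *\<^sub>R u1)"
    by (simp add: p_def) (intro vec_bigo_add mon; simp)
  have p3: "vec_bigo F 3 (\<lambda>h. p h - (h *\<^sub>R u1 + h^2 *\<^sub>R u2))"
    by (simp add: p_def) (intro mon; simp)
  have h1: "vec_bigo F 1 (\<lambda>h. h *\<^sub>R u1)"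
    using mon[of 1 1 u1] by simp
  have h2: "vec_bigo F 2 (\<lambda>h. h^2 *\<^sub>R u2)" by (rule mon) simp
  have d0: "vec_bigo F 0 d" by (rule vec_bigo_tendsto[OF d])

  \<comment> \<open>For \<open>n = 0\<close> the hypothesis on \<open>d\<close> yields only
    boundedness; for larger \<open>n\<close> it yields O(h), the order of \<open>p\<close>. In both
    cases the fourth power is O(h^n), since \<open>n \<le> 4\<close>.\<close>
  have "vec_bigo F (min n 1) (\<lambda>h. e h + p h)"
    by (intro vec_bigo_add mono[OF e] mono[OF p1]) auto
  then have "vec_bigo F (min n 1) d" by (simp add: e_def)
  from vec_bigo_norm_power[OF this, of 4] have "vec_bigo F n (\<lambda>h. norm (d h) ^ 4)"
    by (rule mono) (use n in \<open>auto simp: min_def\<close>)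
  then have rem: "vec_bigo F n (\<lambda>h. f (x + d h) - (f x + A (d h) + B (d h) (d h) + C (d h) (d h) (d h)))"
  proof (rule vec_bigo_norm_le)
    have "\<forall>\<^sub>F h in F. norm (d h) < r"
      using tendstoD[OF d T(1)] by simp
    then show "\<forall>\<^sub>F h in F. norm (f (x + d h) - (f x + A (d h) + B (d h) (d h) + C (d h) (d h) (d h)))
        \<le> L * norm (norm (d h) ^ 4)"
      by eventually_elim (use T(2) in simp)
  qed

  have XA: "vec_bigo F n (\<lambda>h. A (e h))" by (rule vec_bigo_bounded_linear[OF A e])
  \<comment> \<open>Telescoping: these two terms are the difference of \<open>B (d h) (d h)\<close>
    and \<open>B (p h) (p h)\<close>. Each contains \<open>e\<close> once, and boundedness of the
    other factor is enough.\<close>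
  have XB: "vec_bigo F n (\<lambda>h. B (e h) (d h) + B (p h) (e h))"
    using vec_bigo_bilinear[OF B e d0] vec_bigo_bilinear[OF B p0 e] by (intro vec_bigo_add) auto
  have XC: "vec_bigo F n (\<lambda>h. C (e h) (d h) (d h) + C (p h) (e h) (d h) + C (p h) (p h) (e h))"
    using vec_bigo_trilinear[of C, OF C(4) e d0 d0] vec_bigo_trilinear[of C, OF C(4) p0 e d0]
      vec_bigo_trilinear[of C, OF C(4) p0 p0 e] by (intro vec_bigo_add) auto
  \<comment> \<open>The part of \<open>B (p h) (p h)\<close> beyond h^3, split so that the orders of
    the two slots are 3+1, 1+3 and 2+2. For \<open>C\<close> below, the first neglected terms have
    orders 2, 1, 1 in some arrangement of the slots.\<close>
  have XBp: "vec_bigo F 4 (\<lambda>h. B (p h - (h *\<^sub>R u1 + h^2 *\<^sub>R u2)) (p h)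
      + B (h *\<^sub>R u1) (p h - (h *\<^sub>R u1 + h^2 *\<^sub>R u2)) + B (h^2 *\<^sub>R u2) (p h - h *\<^sub>R u1))"
    using vec_bigo_bilinear[OF B p3 p1] vec_bigo_bilinear[OF B h1 p3] vec_bigo_bilinear[OF B h2 p2]
    by (intro vec_bigo_add) auto
  have XCp: "vec_bigo F 4 (\<lambda>h. C (p h - h *\<^sub>R u1) (p h) (p h) + C (h *\<^sub>R u1) (p h - h *\<^sub>R u1) (p h)
      + C (h *\<^sub>R u1) (h *\<^sub>R u1) (p h - h *\<^sub>R u1))"
    using vec_bigo_trilinear[of C, OF C(4) p2 p1 p1] vec_bigo_trilinear[of C, OF C(4) h1 p2 p1]
      vec_bigo_trilinear[of C, OF C(4) h1 h1 p2] by (intro vec_bigo_add) (auto simp: numeral_eq_Suc)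
  have "vec_bigo F n (\<lambda>h.
      (f (x + d h) - (f x + A (d h) + B (d h) (d h) + C (d h) (d h) (d h)))
      + (A (e h) + (B (e h) (d h) + B (p h) (e h))
        + (C (e h) (d h) (d h) + C (p h) (e h) (d h) + C (p h) (p h) (e h)))
      + ((B (p h - (h *\<^sub>R u1 + h^2 *\<^sub>R u2)) (p h)
        + B (h *\<^sub>R u1) (p h - (h *\<^sub>R u1 + h^2 *\<^sub>R u2)) + B (h^2 *\<^sub>R u2) (p h - h *\<^sub>R u1))
      + (C (p h - h *\<^sub>R u1) (p h) (p h) + C (h *\<^sub>R u1) (p h - h *\<^sub>R u1) (p h)
        + C (h *\<^sub>R u1) (h *\<^sub>R u1) (p h - h *\<^sub>R u1))))"
    using vec_bigo_add[OF vec_bigo_add[OF rem vec_bigo_add[OF vec_bigo_add[OF XA XB] XC]]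
        mono[OF vec_bigo_add[OF XBp XCp] n]] .
  moreover have "(f (x + d h) - (f x + A (d h) + B (d h) (d h) + C (d h) (d h) (d h)))
      + (A (e h) + (B (e h) (d h) + B (p h) (e h))
        + (C (e h) (d h) (d h) + C (p h) (e h) (d h) + C (p h) (p h) (e h)))
      + ((B (p h - (h *\<^sub>R u1 + h^2 *\<^sub>R u2)) (p h)
        + B (h *\<^sub>R u1) (p h - (h *\<^sub>R u1 + h^2 *\<^sub>R u2)) + B (h^2 *\<^sub>R u2) (p h - h *\<^sub>R u1))
      + (C (p h - h *\<^sub>R u1) (p h) (p h) + C (h *\<^sub>R u1) (p h - h *\<^sub>R u1) (p h)
        + C (h *\<^sub>R u1) (h *\<^sub>R u1) (p h - h *\<^sub>R u1)))
    = f (x + d h) - (f x + h *\<^sub>R A u1 + h^2 *\<^sub>R (A u2 + B u1 u1)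
     + h^3 *\<^sub>R (A u3 + B u1 u2 + B u2 u1 + C u1 u1 u1))" for h
  proof -
    note lin = C(1-3)
    have dA: "A (d h) = A (e h) + A (p h)" by (simp add: e_def A.diff)
    have Ap: "A (p h) = h *\<^sub>R A u1 + h^2 *\<^sub>R A u2 + h^3 *\<^sub>R A u3"
      by (simp add: p_def A.add A.scaleR)
    have dB: "B (d h) (d h) = (B (e h) (d h) + B (p h) (e h)) + B (p h) (p h)"
      by (simp add: e_def B.diff_left B.diff_right)
    have dC: "C (d h) (d h) (d h) =
        (C (e h) (d h) (d h) + C (p h) (e h) (d h) + C (p h) (p h) (e h)) + C (p h) (p h) (p h)"
      by (simp add: e_def linear_diff[OF lin(1)] linear_diff[OF lin(2)] linear_diff[OF lin(3)])
    have Bp: "B (p h) (p h) = h^2 *\<^sub>R B u1 u1 + h^3 *\<^sub>R (B u1 u2 + B u2 u1) +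
        (B (p h - (h *\<^sub>R u1 + h^2 *\<^sub>R u2)) (p h)
        + B (h *\<^sub>R u1) (p h - (h *\<^sub>R u1 + h^2 *\<^sub>R u2)) + B (h^2 *\<^sub>R u2) (p h - h *\<^sub>R u1))"
      by (simp add: B.diff_left B.diff_right B.add_left B.add_right B.scaleR_left B.scaleR_right
          scaleR_add_right scaleR_diff_right power2_eq_square power3_eq_cube mult.assoc)
    have Cp: "C (p h) (p h) (p h) = h^3 *\<^sub>R C u1 u1 u1 +
        (C (p h - h *\<^sub>R u1) (p h) (p h) + C (h *\<^sub>R u1) (p h - h *\<^sub>R u1) (p h)
        + C (h *\<^sub>R u1) (h *\<^sub>R u1) (p h - h *\<^sub>R u1))"
      by (simp add: linear_diff[OF lin(1)] linear_diff[OF lin(2)] linear_diff[OF lin(3)]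
          linear_scale[OF lin(1)] linear_scale[OF lin(2)] linear_scale[OF lin(3)]
          scaleR_add_right scaleR_diff_right power3_eq_cube mult.assoc)
    show ?thesis
      unfolding dA dB dC Ap Bp Cp by (simp add: scaleR_add_right)
  qed
  ultimately show ?thesis by simp
qed

text \<open>The mean value inequality on the segment between 0 and \<open>h\<close>, which lies in
  the interval \<open>S\<close>, supplies the extra factor of absolute value of \<open>h\<close> for
  either sign of \<open>h\<close>.\<close>

lemma vec_bigo_integrate:
  fixes e :: "real \<Rightarrow> 'a::real_normed_vector"
  assumes S: "is_interval S" "0 \<in> S"
    and e: "\<And>s. s \<in> S \<Longrightarrow> (e has_vector_derivative e' s) (at s within S)" "e 0 = 0" "e' 0 = 0"
    and big: "vec_bigo (at 0 within S) n e'"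
  shows "vec_bigo (at 0 within S) (Suc n) e"
  using big
proof (rule vec_bigoE)
  fix K :: real assume K: "K > 0" "\<forall>\<^sub>F h in at 0 within S. norm (e' h) \<le> K * \<bar>h\<bar> ^ n"
  then obtain \<delta> where \<delta>: "\<delta> > 0" "\<And>s. s \<in> S \<Longrightarrow> s \<noteq> 0 \<Longrightarrow> \<bar>s\<bar> < \<delta> \<Longrightarrow> norm (e' s) \<le> K * \<bar>s\<bar> ^ n"
    unfolding eventually_at by (auto simp: dist_norm)
  have "norm (e h) \<le> K * \<bar>h\<bar> ^ Suc n" if h: "h \<in> S" "\<bar>h\<bar> < \<delta>" for h
  proof -
    let ?I = "closed_segment 0 h"
    have I: "?I \<subseteq> S"
      using S h(1) by (meson closed_segment_subset is_interval_convex)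
    have small: "\<bar>s\<bar> \<le> \<bar>h\<bar>" if "s \<in> ?I" for s
      using that by (auto simp: closed_segment_eq_real_ivl split: if_splits)
    have "norm (e h - e 0) \<le> K * \<bar>h\<bar> ^ n * norm (h - 0)"
    proof (rule differentiable_bound[of ?I e "\<lambda>s t. t *\<^sub>R e' s"])
      fix s assume s: "s \<in> ?I"
      show "(e has_derivative (\<lambda>t. t *\<^sub>R e' s)) (at s within ?I)"
        using e(1)[of s] s I unfolding has_vector_derivative_def
        by (blast intro: has_derivative_subset)
      have "norm (e' s) \<le> K * \<bar>h\<bar> ^ n"
      \<comment> \<open>The filter says nothing about the point 0 itself, which lies on the segment;
        there \<open>e' 0 = 0\<close> is used.\<close>
      proof (cases "s = 0")
        case False
        have "norm (e' s) \<le> K * \<bar>s\<bar> ^ n"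
          using \<delta>(2)[OF _ False] s I small[OF s] h by auto
        also have "\<dots> \<le> K * \<bar>h\<bar> ^ n"
          using K(1) small[OF s] by (intro mult_left_mono power_mono) auto
        finally show ?thesis .
      qed (use e(3) K(1) in simp)
      then show "onorm (\<lambda>t. t *\<^sub>R e' s) \<le> K * \<bar>h\<bar> ^ n"
        by (intro onorm_le) (simp add: mult.commute[of _ "\<bar>_\<bar>"] mult_left_mono)
    qed auto
    then show ?thesis by (simp add: e(2) mult_ac)
  qed
  then show ?thesis
    using \<delta>(1) by (intro vec_bigoI[where K = K]) (auto simp: eventually_at intro!: exI[of _ \<delta>])
qed

section \<open>Bootstrapped expansions from third order Taylor data\<close>

text \<open>Here \<open>f\<close> stands for the full right-hand side of the autonomous equation,
  later \<open>- (M *v v) + f v\<close>. Its Taylor data at \<open>x\<close> serve the exact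
  solution and the stages alike.\<close>

locale cubic_Taylor =
  fixes f :: "'a::real_normed_vector \<Rightarrow> 'a" and x :: 'a
    and A :: "'a \<Rightarrow> 'a" and B :: "'a \<Rightarrow> 'a \<Rightarrow> 'a" and C :: "'a \<Rightarrow> 'a \<Rightarrow> 'a \<Rightarrow> 'a" and K L r :: real
  assumes A: "bounded_linear A" and B: "bounded_bilinear B"
    and C: "\<And>v w. linear (\<lambda>u. C u v w)" "\<And>u w. linear (\<lambda>v. C u v w)" "\<And>u v. linear (C u v)"
      "\<And>u v w. norm (C u v w) \<le> K * norm u * norm v * norm w"
    and r: "r > 0"
    and remainder: "norm d < r \<Longrightarrow> norm (f (x + d) - (f x + A d + B d d + C d d d)) \<le> L * norm d ^ 4"
begin

text \<open>
  A stage with weights \<open>a\<^sub>i\<^sub>j\<close> has \<open>c = \<Sum> a\<^sub>i\<^sub>j\<close>, \<open>e = \<Sum> a\<^sub>i\<^sub>j c\<^sub>j\<close>, \<open>\<alpha> = \<Sum> a\<^sub>i\<^sub>j e\<^sub>j\<close>, \<open>\<beta> = \<Sum> a\<^sub>i\<^sub>j c\<^sub>j\<^sup>2\<close>; the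
  exact solution has \<open>1, 1/2, 1/6, 1/3\<close>.  \<open>B\<close> and \<open>C\<close> already contain the factors \<open>1/2\<close> and \<open>1/6\<close>.
\<close>

definition stage_poly :: "real \<Rightarrow> real \<Rightarrow> real \<Rightarrow> real \<Rightarrow> real \<Rightarrow> 'a" where
  "stage_poly c e \<alpha> \<beta> h =
     h *\<^sub>R c *\<^sub>R f x + h^2 *\<^sub>R e *\<^sub>R A (f x) + h^3 *\<^sub>R (\<alpha> *\<^sub>R A (A (f x)) + \<beta> *\<^sub>R B (f x) (f x))"

text \<open>The terms are the four elementary differentials of order four, the two orders of
  arguments of \<open>B\<close> forming one of them. The coefficient has its own name because it is
  the only part of the slope that reaches h^4 after integration or multiplication by
  \<open>h\<close>.\<close>

definition slope_coeff :: "real \<Rightarrow> real \<Rightarrow> real \<Rightarrow> real \<Rightarrow> 'a" where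
  "slope_coeff c e \<alpha> \<beta> = \<alpha> *\<^sub>R A (A (A (f x))) + \<beta> *\<^sub>R A (B (f x) (f x))
     + (c * e) *\<^sub>R (B (f x) (A (f x)) + B (A (f x)) (f x)) + c^3 *\<^sub>R C (f x) (f x) (f x)"

definition slope_poly :: "real \<Rightarrow> real \<Rightarrow> real \<Rightarrow> real \<Rightarrow> real \<Rightarrow> 'a" where
  "slope_poly c e \<alpha> \<beta> h = f x + h *\<^sub>R c *\<^sub>R A (f x)
     + h^2 *\<^sub>R (e *\<^sub>R A (A (f x)) + c^2 *\<^sub>R B (f x) (f x)) + h^3 *\<^sub>R slope_coeff c e \<alpha> \<beta>"

lemma vec_bigo_slope_poly:
  assumes "F \<le> at 0" "(d \<longlongrightarrow> 0) F" "vec_bigo F n (\<lambda>h. d h - stage_poly c e \<alpha> \<beta> h)" "n \<le> 4"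
  shows "vec_bigo F n (\<lambda>h. f (x + d h) - slope_poly c e \<alpha> \<beta> h)"
proof -
  interpret A: bounded_linear A by (rule A)
  interpret B: bounded_bilinear B by (rule B)
  from vec_bigo_compose_Taylor[OF assms(1) A B C r remainder assms(2) assms(3)[unfolded stage_poly_def] assms(4)]
  show ?thesis
    by (simp add: slope_poly_def slope_coeff_def A.add A.scaleR B.scaleR_left B.scaleR_right
        linear_scale[OF C(1)] linear_scale[OF C(2)] linear_scale[OF C(3)]
        power2_eq_square power3_eq_cube scaleR_add_right mult_ac add_ac)
qed

lemma stage_poly_tendsto: "F \<le> at 0 \<Longrightarrow> (stage_poly c e \<alpha> \<beta> \<longlongrightarrow> 0) F"
proof (rule tendsto_mono[of F "at 0"])
  have "(stage_poly c e \<alpha> \<beta> \<longlongrightarrow> stage_poly c e \<alpha> \<beta> 0) (at 0)"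
    unfolding stage_poly_def[abs_def] by (intro tendsto_intros)
  then show "(stage_poly c e \<alpha> \<beta> \<longlongrightarrow> 0) (at 0)" by (simp add: stage_poly_def)
qed

text \<open>The numbers 1, 1/2, 1/6, 1/3 are those for which the derivative of the candidate
  polynomial is \<open>slope_poly\<close> with the same arguments. The error \<open>e\<close>
  therefore has derivative \<open>f (z s) - slope_poly 1 (1/2) (1/6) (1/3) s\<close>: an error of
  order \<open>n\<close> gives a derivative of order \<open>n\<close>, and integration gives order
  \<open>n + 1\<close>.\<close>

theorem solution_expansion:
  assumes S: "is_interval S" "0 \<in> S"
    and z: "\<And>s. s \<in> S \<Longrightarrow> (z has_vector_derivative f (z s)) (at s within S)" "z 0 = x"
  shows "vec_bigo (at 0 within S) 5 (\<lambda>h. z h - (x + stage_poly 1 (1/2) (1/6) (1/3) h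
     + h^4 *\<^sub>R (1/4) *\<^sub>R slope_coeff 1 (1/2) (1/6) (1/3)))"
proof -
  let ?F = "at 0 within S"
  have F: "?F \<le> at 0" by (simp add: at_le)
  define e where "e h = z h - (x + stage_poly 1 (1/2) (1/6) (1/3) h
     + h^4 *\<^sub>R (1/4) *\<^sub>R slope_coeff 1 (1/2) (1/6) (1/3))" for h
  have z0: "((\<lambda>h. z h - x) \<longlongrightarrow> 0) ?F"
    using has_vector_derivative_continuous[OF z(1)[OF S(2)]]
    by (simp add: continuous_within z(2) LIM_zero)
  have e_deriv: "(e has_vector_derivative f (z s) - slope_poly 1 (1/2) (1/6) (1/3) s) (at s within S)"
    if "s \<in> S" for s
    unfolding e_def[abs_def] stage_poly_def slope_poly_def
    by (auto intro!: derivative_eq_intros z(1)[OF that] simp: algebra_simps)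
  have "vec_bigo ?F n e" if "n \<le> 5" for n
    using that
  proof (induction n)
    case 0
    have "((\<lambda>h. (z h - x) - stage_poly 1 (1/2) (1/6) (1/3) h
        - h^4 *\<^sub>R (1/4) *\<^sub>R slope_coeff 1 (1/2) (1/6) (1/3)) \<longlongrightarrow>
      0 - 0 - 0 ^ 4 *\<^sub>R (1/4) *\<^sub>R slope_coeff 1 (1/2) (1/6) (1/3)) ?F"
      by (intro tendsto_intros z0 stage_poly_tendsto F)
    then show ?case by (intro vec_bigo_tendsto[of _ 0]) (simp add: e_def[abs_def] algebra_simps)
  next
    case (Suc n)
    then have n: "vec_bigo ?F n e" "n \<le> 4" by auto
    \<comment> \<open>The h^4 term may be added back because \<open>n \<le> 4\<close>; what remains
      is the cubic displacement that \<open>vec_bigo_slope_poly\<close> expects.\<close>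
    have "vec_bigo ?F n (\<lambda>h. e h + h^4 *\<^sub>R (1/4) *\<^sub>R slope_coeff 1 (1/2) (1/6) (1/3))"
      by (intro vec_bigo_add n vec_bigo_monomial F)
    then have "vec_bigo ?F n (\<lambda>h. (z h - x) - stage_poly 1 (1/2) (1/6) (1/3) h)"
      by (simp add: e_def algebra_simps)
    from vec_bigo_slope_poly[OF F z0 this n(2)]
    have "vec_bigo ?F n (\<lambda>h. f (z h) - slope_poly 1 (1/2) (1/6) (1/3) h)" by simp
    moreover have "e 0 = 0" "f (z 0) - slope_poly 1 (1/2) (1/6) (1/3) 0 = 0"
      by (simp_all add: e_def z(2) stage_poly_def slope_poly_def)
    ultimately show ?case
      using vec_bigo_integrate[OF S e_deriv] by blast
  qed
  from this[of 5] show ?thesis by (simp add: e_def[abs_def])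
qed

text \<open>Each implicit equation involves both stages, so the two expansions are improved
  together: order \<open>n\<close> for both displacements gives order \<open>n\<close> for both
  slopes, and the factor \<open>h\<close> in the equations gives order \<open>n + 1\<close>. The
  cubic polynomials allow this up to order four.\<close>

theorem stages_expansion:
  assumes F: "F \<le> at 0"
    and Y: "\<forall>\<^sub>F h in F. Y1 h = x + h *\<^sub>R (a11 *\<^sub>R f (Y1 h) + a12 *\<^sub>R f (Y2 h))"
      "\<forall>\<^sub>F h in F. Y2 h = x + h *\<^sub>R (a21 *\<^sub>R f (Y1 h) + a22 *\<^sub>R f (Y2 h))"
    and lim: "(Y1 \<longlongrightarrow> x) F" "(Y2 \<longlongrightarrow> x) F"
    and c: "c1 = a11 + a12" "c2 = a21 + a22"
    and e: "e1 = a11 * c1 + a12 * c2" "e2 = a21 * c1 + a22 * c2"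
    and \<alpha>: "\<alpha>1 = a11 * e1 + a12 * e2" "\<alpha>2 = a21 * e1 + a22 * e2"
    and \<beta>: "\<beta>1 = a11 * c1^2 + a12 * c2^2" "\<beta>2 = a21 * c1^2 + a22 * c2^2"
  shows "vec_bigo F 4 (\<lambda>h. Y1 h - x - stage_poly c1 e1 \<alpha>1 \<beta>1 h)"
    and "vec_bigo F 4 (\<lambda>h. Y2 h - x - stage_poly c2 e2 \<alpha>2 \<beta>2 h)"
    and "vec_bigo F 4 (\<lambda>h. f (Y1 h) - slope_poly c1 e1 \<alpha>1 \<beta>1 h)"
    and "vec_bigo F 4 (\<lambda>h. f (Y2 h) - slope_poly c2 e2 \<alpha>2 \<beta>2 h)"
proof -
  let ?p1 = "stage_poly c1 e1 \<alpha>1 \<beta>1" and ?p2 = "stage_poly c2 e2 \<alpha>2 \<beta>2"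
  let ?q1 = "slope_poly c1 e1 \<alpha>1 \<beta>1" and ?q2 = "slope_poly c2 e2 \<alpha>2 \<beta>2"
  let ?s1 = "slope_coeff c1 e1 \<alpha>1 \<beta>1" and ?s2 = "slope_coeff c2 e2 \<alpha>2 \<beta>2"
  have d0: "((\<lambda>h. Y1 h - x) \<longlongrightarrow> 0) F" "((\<lambda>h. Y2 h - x) \<longlongrightarrow> 0) F"
    using lim by (auto intro: LIM_zero)
  have slope: "vec_bigo F n (\<lambda>h. f (Y1 h) - ?q1 h)" "vec_bigo F n (\<lambda>h. f (Y2 h) - ?q2 h)"
    if "n \<le> 4" "vec_bigo F n (\<lambda>h. Y1 h - x - ?p1 h)" "vec_bigo F n (\<lambda>h. Y2 h - x - ?p2 h)" for n
    using vec_bigo_slope_poly[OF F d0(1) that(2,1)] vec_bigo_slope_poly[OF F d0(2) that(3,1)] by simp_all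
  \<comment> \<open>One pass through a stage equation with weights \<open>a\<close>,
    \<open>b\<close>. The polynomial \<open>p\<close> collects the inserted slopes without their h^3
    coefficients; after multiplication by \<open>h\<close> these contribute O(h^4), harmless while
    \<open>Suc n \<le> 4\<close>.\<close>
  have step: "vec_bigo F (Suc n) (\<lambda>h. Y h - x - p h)"
    if Y: "\<forall>\<^sub>F h in F. Y h = x + h *\<^sub>R (a *\<^sub>R f (Y1 h) + b *\<^sub>R f (Y2 h))"
      and p: "\<And>h. p h = h *\<^sub>R (a *\<^sub>R ?q1 h + b *\<^sub>R ?q2 h) - h ^ 4 *\<^sub>R (a *\<^sub>R ?s1 + b *\<^sub>R ?s2)"
      and n: "Suc n \<le> 4"
      and IH: "vec_bigo F n (\<lambda>h. f (Y1 h) - ?q1 h)" "vec_bigo F n (\<lambda>h. f (Y2 h) - ?q2 h)"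
    for Y p n a b
  proof (rule vec_bigo_cong)
    show "\<forall>\<^sub>F h in F. Y h - x - p h = h ^ 1 *\<^sub>R (a *\<^sub>R (f (Y1 h) - ?q1 h) + b *\<^sub>R (f (Y2 h) - ?q2 h))
        + h ^ 4 *\<^sub>R (a *\<^sub>R ?s1 + b *\<^sub>R ?s2)"
      using Y by eventually_elim (simp add: p algebra_simps)
    have "vec_bigo F (1 + n) (\<lambda>h. h ^ 1 *\<^sub>R (a *\<^sub>R (f (Y1 h) - ?q1 h) + b *\<^sub>R (f (Y2 h) - ?q2 h)))"
      by (intro vec_bigo_power_scaleR vec_bigo_add vec_bigo_scaleR IH)
    then show "vec_bigo F (Suc n) (\<lambda>h. h ^ 1 *\<^sub>R (a *\<^sub>R (f (Y1 h) - ?q1 h) + b *\<^sub>R (f (Y2 h) - ?q2 h))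
        + h ^ 4 *\<^sub>R (a *\<^sub>R ?s1 + b *\<^sub>R ?s2))"
      by (intro vec_bigo_add vec_bigo_monomial F n) simp
  qed
  \<comment> \<open>The recursions for \<open>c\<close>, \<open>e\<close>, \<open>\<alpha>\<close>
    and \<open>\<beta>\<close> are exactly those under which inserting the slope polynomials
    reproduces the stage polynomial.\<close>
  have p: "stage_poly (a + b) (a * c1 + b * c2) (a * e1 + b * e2) (a * c1^2 + b * c2^2) h =
      h *\<^sub>R (a *\<^sub>R ?q1 h + b *\<^sub>R ?q2 h) - h ^ 4 *\<^sub>R (a *\<^sub>R ?s1 + b *\<^sub>R ?s2)" for a b h
    by (simp add: stage_poly_def slope_poly_def algebra_simps power2_eq_square power3_eq_cube power4_eq_xxxx)
  have "vec_bigo F n (\<lambda>h. Y1 h - x - ?p1 h) \<and> vec_bigo F n (\<lambda>h. Y2 h - x - ?p2 h)" if "n \<le> 4" for n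
    using that
  proof (induction n)
    case 0
    show ?case
      by (intro conjI vec_bigo_tendsto[of _ "0 - 0"] tendsto_diff d0 stage_poly_tendsto F)
  next
    case (Suc n)
    then have n: "n \<le> 4" and IH: "vec_bigo F n (\<lambda>h. Y1 h - x - ?p1 h)" "vec_bigo F n (\<lambda>h. Y2 h - x - ?p2 h)"
      by auto
    have "?p1 h = h *\<^sub>R (a11 *\<^sub>R ?q1 h + a12 *\<^sub>R ?q2 h) - h ^ 4 *\<^sub>R (a11 *\<^sub>R ?s1 + a12 *\<^sub>R ?s2)" for h
      by (subst p[symmetric]) (simp add: c e \<alpha> \<beta>)
    moreover have "?p2 h = h *\<^sub>R (a21 *\<^sub>R ?q1 h + a22 *\<^sub>R ?q2 h) - h ^ 4 *\<^sub>R (a21 *\<^sub>R ?s1 + a22 *\<^sub>R ?s2)" for h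
      by (subst p[symmetric]) (simp add: c e \<alpha> \<beta>)
    ultimately show ?case
      using step[OF Y(1) _ Suc.prems slope[OF n IH]] step[OF Y(2) _ Suc.prems slope[OF n IH]] by blast
  qed
  from this[of 4] show 1: "vec_bigo F 4 (\<lambda>h. Y1 h - x - ?p1 h)" "vec_bigo F 4 (\<lambda>h. Y2 h - x - ?p2 h)"
    by auto
  show "vec_bigo F 4 (\<lambda>h. f (Y1 h) - ?q1 h)" "vec_bigo F 4 (\<lambda>h. f (Y2 h) - ?q2 h)"
    using slope[OF _ 1] by auto
qed

end

subsection \<open>The matrix exponential and the order of the method\<close>

lemma matrix_power_0 [simp]: "matrix_power A 0 = mat 1"
  and matrix_power_Suc [simp]: "matrix_power A (Suc k) = A ** matrix_power A k"
  by (simp_all add: matrix_power_def)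

lemma matrix_power_scaleR: "matrix_power (c *\<^sub>R A) k = c ^ k *\<^sub>R matrix_power A k"
  by (induction k) (simp_all add: matrix_scalar_ac flip: scalar_matrix_assoc)

lemma bounded_bilinear_matrix_matrix_mult:
  "bounded_bilinear ((**) :: real^'n^'m \<Rightarrow> real^'k^'n \<Rightarrow> real^'k^'m)"
  unfolding bilinear_conv_bounded_bilinear[symmetric] bilinear_def
  by (auto intro!: linearI
      simp: matrix_matrix_mult_def vec_eq_iff algebra_simps sum.distrib sum_distrib_left)

text \<open>Bounded bilinearity gives submultiplicativity of the norm only up to a factor
  \<open>C\<close>. Taking \<open>K = norm A * C\<close> absorbs it and leaves geometric
  growth.\<close>

lemma norm_matrix_power_le:
  fixes A :: "real^'n^'n"
  obtains K where "K \<ge> 0" "\<And>k. norm (matrix_power A k) \<le> norm (mat 1 :: real^'n^'n) * K ^ k"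
proof -
  obtain C where C: "C \<ge> 0" "\<And>(X :: real^'n^'n) (Y :: real^'n^'n). norm (X ** Y) \<le> norm X * norm Y * C"
    using bounded_bilinear.nonneg_bounded[OF bounded_bilinear_matrix_matrix_mult] by blast
  have "norm (matrix_power A k) \<le> norm (mat 1 :: real^'n^'n) * (norm A * C) ^ k" for k
  proof (induction k)
    case (Suc k)
    have "norm (matrix_power A (Suc k)) \<le> norm A * norm (matrix_power A k) * C"
      using C(2) by simp
    also have "\<dots> \<le> norm A * (norm (mat 1 :: real^'n^'n) * (norm A * C) ^ k) * C"
      using C(1) Suc.IH by (intro mult_right_mono mult_left_mono) auto
    finally show ?case by (simp add: mult_ac)
  qed simp
  then show ?thesis using C(1) that[of "norm A * C"] by simp
qed

text \<open>Comparison with the scalar exponential series makes the coefficients absolutely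
  summable. For steps of absolute value below 1 the tail from index \<open>p\<close> on is then
  bounded by a constant times the \<open>p\<close>-th power of that value.\<close>

lemma matrix_exp_expansion:
  fixes A :: "real^'n^'n"
  assumes F: "F \<le> at 0"
  shows "vec_bigo F p (\<lambda>h. matrix_exp (h *\<^sub>R A) - (\<Sum>k<p. h ^ k *\<^sub>R (1 / fact k) *\<^sub>R matrix_power A k))"
proof -
  define c where "c k = (1 / fact k) *\<^sub>R matrix_power A k" for k
  obtain K where K: "K \<ge> 0" "\<And>k. norm (matrix_power A k) \<le> norm (mat 1 :: real^'n^'n) * K ^ k"
    using norm_matrix_power_le[of A] by blast
  have c: "summable (\<lambda>k. norm (c k))"
  proof (rule summable_comparison_test')
    show "summable (\<lambda>k. norm (mat 1 :: real^'n^'n) * (inverse (fact k) * K ^ k))"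
      by (intro summable_mult summable_exp)
    show "norm (norm (c k)) \<le> norm (mat 1 :: real^'n^'n) * (inverse (fact k) * K ^ k)" for k
      using K(2)[of k] by (simp add: c_def field_simps)
  qed
  have "norm (matrix_exp (h *\<^sub>R A) - (\<Sum>k<p. h ^ k *\<^sub>R c k)) \<le> (\<Sum>k. norm (c (k + p))) * \<bar>h\<bar> ^ p"
    if h: "\<bar>h\<bar> < 1" for h
  proof -
    have le: "norm (h ^ k *\<^sub>R c k) \<le> norm (c k)" for k
      using h power_le_one[of "\<bar>h\<bar>" k] by (simp add: power_abs mult_left_le_one_le)
    have "summable (\<lambda>k. h ^ k *\<^sub>R c k)"
      by (rule summable_comparison_test'[OF c]) (rule le)
    then have "(\<Sum>k. h ^ k *\<^sub>R c k) = (\<Sum>k. h ^ (k + p) *\<^sub>R c (k + p)) + (\<Sum>k<p. h ^ k *\<^sub>R c k)"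
      by (rule suminf_split_initial_segment)
    moreover have "matrix_exp (h *\<^sub>R A) = (\<Sum>k. h ^ k *\<^sub>R c k)"
      by (simp add: matrix_exp_def matrix_power_scaleR c_def)
    ultimately have "matrix_exp (h *\<^sub>R A) - (\<Sum>k<p. h ^ k *\<^sub>R c k) = (\<Sum>k. h ^ (k + p) *\<^sub>R c (k + p))"
      by simp
    also have "norm \<dots> \<le> (\<Sum>k. norm (c (k + p)) * \<bar>h\<bar> ^ p)"
    proof (rule norm_suminf_le)
      show "norm (h ^ (k + p) *\<^sub>R c (k + p)) \<le> norm (c (k + p)) * \<bar>h\<bar> ^ p" for k
      proof -
        have "\<bar>h\<bar> ^ k * (\<bar>h\<bar> ^ p * norm (c (k + p))) \<le> 1 * (\<bar>h\<bar> ^ p * norm (c (k + p)))"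
          using h by (intro mult_right_mono power_le_one) auto
        then show ?thesis by (simp add: power_add power_abs abs_mult mult_ac)
      qed
      show "summable (\<lambda>k. norm (c (k + p)) * \<bar>h\<bar> ^ p)"
        by (intro summable_mult2 summable_ignore_initial_segment c)
    qed
    also have "\<dots> = (\<Sum>k. norm (c (k + p))) * \<bar>h\<bar> ^ p"
      by (intro suminf_mult2[symmetric] summable_ignore_initial_segment c)
    finally show ?thesis .
  qed
  moreover have "\<forall>\<^sub>F h in F. \<bar>h\<bar> < 1"
    using F by (rule filter_leD) (auto simp: eventually_at intro!: exI[of _ 1])
  ultimately show ?thesis
    by (intro vec_bigoI[where K = "\<Sum>k. norm (c (k + p))"]) (auto elim: eventually_mono simp: c_def)
qed

section \<open>Taylor data of the right-hand side and order four of the method\<close>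

text \<open>The linear term \<open>- (M *v v)\<close> affects only the value and the first
  derivative; the second and third derivatives and the remainder are those of
  \<open>f\<close>.\<close>

lemma cubic_Taylor_minus_linear:
  fixes f :: "real^'m \<Rightarrow> real^'m" and M :: "real^'m^'m"
  assumes U: "open U" "x \<in> U" and f: "Ck_on 4 U f"
  shows "\<exists>K L r. cubic_Taylor (\<lambda>v. - (M *v v) + f v) x (\<lambda>v. jacobian f (at x) *v v - M *v v)
    (\<lambda>u v. (1/2) *\<^sub>R second_derivative f x u v) (\<lambda>u v w. (1/6) *\<^sub>R third_derivative f x u v w) K L r"
proof -
  obtain L r where L: "r > 0"
    "\<And>d. norm d < r \<Longrightarrow> norm (f (x + d) - (f x + frechet_derivative f (at x) d
       + (1/2) *\<^sub>R second_derivative f x d d + (1/6) *\<^sub>R third_derivative f x d d d)) \<le> L * norm d ^ 4"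
    using Ck_on_4_Taylor[OF U f] by blast
  obtain K where K: "\<And>u v w. norm (third_derivative f x u v w) \<le> K * norm u * norm v * norm w"
    using third_derivative_bound[OF U(1) f U(2)] by blast
  \<comment> \<open>The Taylor formula speaks of the Frechet derivative, the correction
    \<open>mverk_w4\<close> of the Jacobian matrix.\<close>
  have J: "frechet_derivative f (at x) = (*v) (jacobian f (at x))"
    using differentiable_iterated_derivatives(1)[OF U(1) f U(2)] jacobian_works frechet_derivative_at by metis
  note lin = linear_iterated_derivatives[OF U(1) f U(2)]
  have "cubic_Taylor (\<lambda>v. - (M *v v) + f v) x (\<lambda>v. jacobian f (at x) *v v - M *v v)
    (\<lambda>u v. (1/2) *\<^sub>R second_derivative f x u v) (\<lambda>u v w. (1/6) *\<^sub>R third_derivative f x u v w) (K / 6) L r"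
  proof (rule cubic_Taylor.intro)
    show "bounded_linear (\<lambda>v. jacobian f (at x) *v v - M *v v)"
      by (intro bounded_linear_sub matrix_vector_mul_bounded_linear)
    show "bounded_bilinear (\<lambda>u v. (1/2) *\<^sub>R second_derivative f x u v)"
      unfolding bilinear_conv_bounded_bilinear[symmetric] bilinear_def
      by (intro conjI allI linear_compose_scale_right lin)
    show "linear (\<lambda>u. (1/6) *\<^sub>R third_derivative f x u v w)"
      "linear (\<lambda>v. (1/6) *\<^sub>R third_derivative f x u v w)"
      "linear (\<lambda>w. (1/6) *\<^sub>R third_derivative f x u v w)" for u v w
      by (intro linear_compose_scale_right lin)+
    show "norm ((1/6) *\<^sub>R third_derivative f x u v w) \<le> K / 6 * norm u * norm v * norm w" for u v w
      using K[of u v w] by simp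
    show "r > 0" by (rule L)
    show "norm (- (M *v (x + d)) + f (x + d) - (- (M *v x) + f x + (jacobian f (at x) *v d - M *v d) +
          (1/2) *\<^sub>R second_derivative f x d d + (1/6) *\<^sub>R third_derivative f x d d d)) \<le> L * norm d ^ 4"
      if "norm d < r" for d
      using L(2)[OF that] by (simp add: J matrix_vector_right_distrib algebra_simps)
  qed
  then show ?thesis by blast
qed

theorem theorem3p2:
  fixes M :: "real^'m^'m"
    and f :: "real^'m \<Rightarrow> real^'m"
    and U :: "(real^'m) set"
    and J :: "real set"
    and t0 :: real
    and y0 :: "real^'m"
    and y Y1 Y2 :: "real \<Rightarrow> real^'m"
    and a11 a12 a21 a22 b1 b2 c1 c2 :: real
  assumes "open U" and "y0 \<in> U" and "Ck_on 4 U f"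
    and "is_interval J" and "t0 \<in> J" and "J \<noteq> {t0}"
    and "solves_ivp f M U J t0 y0 y"
    and "mverk_stages (step_filter t0 J) M f y0 a11 a12 a21 a22 Y1 Y2"
    and "c1 = a11 + a12" and "c2 = a21 + a22"
    and "b1 + b2 = 1"
    and "b1 * c1 + b2 * c2 = 1/2"
    and "b1 * c1^2 + b2 * c2^2 = 1/3"
    and "b1 * (a11 * c1 + a12 * c2) + b2 * (a21 * c1 + a22 * c2) = 1/6"
    and "b1 * c1^3 + b2 * c2^3 = 1/4"
    and "b1 * c1 * (a11 * c1 + a12 * c2) + b2 * c2 * (a21 * c1 + a22 * c2) = 1/8"
    and "b1 * (a11 * c1^2 + a12 * c2^2) + b2 * (a21 * c1^2 + a22 * c2^2) = 1/12"
    and "(b1 * a11 + b2 * a21) * (a11 * c1 + a12 * c2)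
         + (b1 * a12 + b2 * a22) * (a21 * c1 + a22 * c2) = 1/24"
  shows "has_order 4 (step_filter t0 J) t0 (mverk_update M f y0 b1 b2 Y1 Y2) y"
proof -
  let ?S = "{h. t0 + h \<in> J}"
  define F where "F = step_filter t0 J"
  have F_eq: "F = at 0 within ?S" by (simp add: F_def step_filter_def)
  then have F: "F \<le> at 0" by (simp add: at_le)
  define g where "g v = - (M *v v) + f v" for v
  define A where "A v = jacobian f (at y0) *v v - M *v v" for v
  define B where "B u v = (1/2) *\<^sub>R second_derivative f y0 u v" for u v
  define C where "C u v w = (1/6) *\<^sub>R third_derivative f y0 u v w" for u v w
  obtain K L r where "cubic_Taylor g y0 A B C K L r"
    using cubic_Taylor_minus_linear[OF assms(1-3), of M]
    unfolding g_def[abs_def] A_def[abs_def] B_def[abs_def] C_def[abs_def] by blast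
  then interpret cubic_Taylor g y0 A B C K L r .

  have S: "is_interval ?S" "0 \<in> ?S"
  proof -
    show "is_interval ?S"
      unfolding is_interval_1
    proof (intro ballI allI impI)
      fix a b s assume "a \<in> ?S" "b \<in> ?S" "a \<le> s \<and> s \<le> b"
      then show "s \<in> ?S"
        using mem_is_interval_1_I[OF assms(4), of "t0 + a" "t0 + b" "t0 + s"] by simp
    qed
  qed (use assms(5) in simp)
  have "((\<lambda>h. y (t0 + h)) has_vector_derivative g (y (t0 + s))) (at s within ?S)" if s: "s \<in> ?S" for s
  proof -
    obtain y' where y': "(y has_vector_derivative y') (at (t0 + s) within J)"
      "y' + M *v y (t0 + s) = f (y (t0 + s))"
      using bspec[OF conjunct1[OF assms(7)[unfolded solves_ivp_def]], of "t0 + s"] s by auto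
    have "y' = g (y (t0 + s))" using y'(2) by (simp add: g_def algebra_simps)
    moreover have "(y has_vector_derivative y') (at (t0 + s) within (+) t0 ` ?S)"
      by (rule has_vector_derivative_within_subset[OF y'(1)], auto)
    ultimately have "((y \<circ> (+) t0) has_vector_derivative 1 *\<^sub>R g (y (t0 + s))) (at s within ?S)"
      by (intro vector_diff_chain_within) (auto intro!: derivative_eq_intros)
    then show ?thesis by (simp add: o_def)
  qed
  moreover have "y (t0 + 0) = y0" using assms(7) by (simp add: solves_ivp_def)
  ultimately have exact: "vec_bigo F 5 (\<lambda>h. y (t0 + h) - (y0 + stage_poly 1 (1/2) (1/6) (1/3) h
      + h^4 *\<^sub>R (1/4) *\<^sub>R slope_coeff 1 (1/2) (1/6) (1/3)))"
    using solution_expansion[OF S] by (simp add: F_eq)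

  define e1 e2 where e: "e1 = a11 * c1 + a12 * c2" "e2 = a21 * c1 + a22 * c2"
  define \<alpha>1 \<alpha>2 where \<alpha>: "\<alpha>1 = a11 * e1 + a12 * e2" "\<alpha>2 = a21 * e1 + a22 * e2"
  define \<beta>1 \<beta>2 where \<beta>: "\<beta>1 = a11 * c1^2 + a12 * c2^2" "\<beta>2 = a21 * c1^2 + a22 * c2^2"
  have Y: "\<forall>\<^sub>F h in F. Y1 h = y0 + h *\<^sub>R (a11 *\<^sub>R g (Y1 h) + a12 *\<^sub>R g (Y2 h))"
    "\<forall>\<^sub>F h in F. Y2 h = y0 + h *\<^sub>R (a21 *\<^sub>R g (Y1 h) + a22 *\<^sub>R g (Y2 h))"
    "(Y1 \<longlongrightarrow> y0) F" "(Y2 \<longlongrightarrow> y0) F"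
    using assms(8) by (auto simp: mverk_stages_def g_def F_def elim: eventually_mono)
  note stages = stages_expansion[OF F Y assms(9,10) e \<alpha> \<beta>]

  \<comment> \<open>The last order condition sums over the first index of the weights first;
    exchanging the sums turns it into a condition on \<open>\<alpha>1\<close> and
    \<open>\<alpha>2\<close>.\<close>
  have b\<alpha>: "b1 * \<alpha>1 + b2 * \<alpha>2 = 1/24"
    using assms(18) by (simp add: \<alpha> e algebra_simps)
  note conditions = assms(11-17)[folded e, folded \<beta>] b\<alpha>
  \<comment> \<open>The weighted stages enter through \<open>f = g + M\<close>, multiplied by
    \<open>h\<close> and \<open>M\<close>, so they matter only up to h^3.\<close>
  have stage_sum: "b1 *\<^sub>R stage_poly c1 e1 \<alpha>1 \<beta>1 h + b2 *\<^sub>R stage_poly c2 e2 \<alpha>2 \<beta>2 h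
      = stage_poly (1/2) (1/6) (1/24) (1/12) h" for h
  proof -
    have "b1 *\<^sub>R stage_poly c1 e1 \<alpha>1 \<beta>1 h + b2 *\<^sub>R stage_poly c2 e2 \<alpha>2 \<beta>2 h =
        stage_poly (b1 * c1 + b2 * c2) (b1 * e1 + b2 * e2) (b1 * \<alpha>1 + b2 * \<alpha>2) (b1 * \<beta>1 + b2 * \<beta>2) h"
      by (simp add: stage_poly_def algebra_simps)
    then show ?thesis by (simp only: conditions)
  qed
  \<comment> \<open>All eight order conditions meet here: this is order four of the underlying
    Runge-Kutta method for \<open>y' = g y\<close>. The values 1/24, 1/12, 1/8, 1/4 are a quarter of
    the weights in \<open>slope_coeff 1 (1/2) (1/6) (1/3)\<close>.\<close>
  have slope_sum: "h *\<^sub>R (b1 *\<^sub>R slope_poly c1 e1 \<alpha>1 \<beta>1 h + b2 *\<^sub>R slope_poly c2 e2 \<alpha>2 \<beta>2 h)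
      = stage_poly 1 (1/2) (1/6) (1/3) h + h^4 *\<^sub>R (1/4) *\<^sub>R slope_coeff 1 (1/2) (1/6) (1/3)" for h
  proof -
    have coeff: "b1 *\<^sub>R slope_coeff c1 e1 \<alpha>1 \<beta>1 + b2 *\<^sub>R slope_coeff c2 e2 \<alpha>2 \<beta>2 =
        (b1 * \<alpha>1 + b2 * \<alpha>2) *\<^sub>R A (A (A (g y0))) + (b1 * \<beta>1 + b2 * \<beta>2) *\<^sub>R A (B (g y0) (g y0))
        + (b1 * c1 * e1 + b2 * c2 * e2) *\<^sub>R (B (g y0) (A (g y0)) + B (A (g y0)) (g y0))
        + (b1 * c1^3 + b2 * c2^3) *\<^sub>R C (g y0) (g y0) (g y0)"
      by (simp add: slope_coeff_def algebra_simps)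
    have "h *\<^sub>R (b1 *\<^sub>R slope_poly c1 e1 \<alpha>1 \<beta>1 h + b2 *\<^sub>R slope_poly c2 e2 \<alpha>2 \<beta>2 h) =
        h *\<^sub>R (b1 + b2) *\<^sub>R g y0 + h^2 *\<^sub>R (b1 * c1 + b2 * c2) *\<^sub>R A (g y0)
        + h^3 *\<^sub>R ((b1 * e1 + b2 * e2) *\<^sub>R A (A (g y0)) + (b1 * c1^2 + b2 * c2^2) *\<^sub>R B (g y0) (g y0))
        + h^4 *\<^sub>R (b1 *\<^sub>R slope_coeff c1 e1 \<alpha>1 \<beta>1 + b2 *\<^sub>R slope_coeff c2 e2 \<alpha>2 \<beta>2)"
      by (simp add: slope_poly_def algebra_simps power2_eq_square power3_eq_cube power4_eq_xxxx)
    also have "\<dots> = stage_poly 1 (1/2) (1/6) (1/3) h + h^4 *\<^sub>R (1/4) *\<^sub>R slope_coeff 1 (1/2) (1/6) (1/3)"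
      unfolding coeff by (simp only: conditions) (simp add: stage_poly_def slope_coeff_def algebra_simps)
    finally show ?thesis .
  qed

  have minus: "(- M) *v v = - (M *v v)" "M *v (- v) = - (M *v v)" for v
    using matrix_vector_mult_diff_rdistrib[of 0 M v] matrix_vector_mult_diff_distrib[of M 0 v] by simp_all
  have eval_linear: "linear (\<lambda>X :: real^'m^'m. X *v y0)"
    by (auto intro!: linearI simp: matrix_vector_mult_add_rdistrib simp flip: scaleR_matrix_vector_assoc)
  \<comment> \<open>An identity exact in \<open>h\<close>. With \<open>g y0 = f y0 - M *v y0\<close>
    each power from h to h^4 cancels separately; at h^2, for instance, half of
    \<open>M *v (M *v y0 + g y0 - f y0)\<close> vanishes.\<close>
  have cancel: "(\<Sum>k<5. h ^ k *\<^sub>R (1 / fact k) *\<^sub>R (matrix_power (- M) k *v y0))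
      + h *\<^sub>R (M *v (y0 + stage_poly (1/2) (1/6) (1/24) (1/12) h)) + mverk_w4 M f y0 h = y0" for h
    by (simp add: mverk_w4_def Let_def stage_poly_def g_def A_def B_def lessThan_nat_numeral fact_numeral
        eval_nat_numeral algebra_simps minus flip: matrix_vector_mul_assoc)

  \<comment> \<open>The Taylor coefficients shared by the exact and the numerical solution; only the
    indices 0 to 4 occur in the sum.\<close>
  define c where "c k = [y0, g y0, (1/2) *\<^sub>R A (g y0), (1/6) *\<^sub>R A (A (g y0)) + (1/3) *\<^sub>R B (g y0) (g y0),
      (1/4) *\<^sub>R slope_coeff 1 (1/2) (1/6) (1/3)] ! k" for k
  have c: "(\<Sum>k\<le>4. h ^ k *\<^sub>R c k) = y0 + stage_poly 1 (1/2) (1/6) (1/3) h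
      + h^4 *\<^sub>R (1/4) *\<^sub>R slope_coeff 1 (1/2) (1/6) (1/3)" for h
    by (simp add: c_def stage_poly_def atMost_nat_numeral atMost_Suc numeral_eq_Suc add_ac)

  \<comment> \<open>There are three sources of error: the tail of the exponential, the slopes and
    the stages. The latter two are O(h^4) and carry an additional factor \<open>h\<close>.\<close>
  have five: "5 = 1 + (4::nat)" by simp
  have N1: "vec_bigo F 5 (\<lambda>h. (matrix_exp (h *\<^sub>R (- M))
      - (\<Sum>k<5. h ^ k *\<^sub>R (1 / fact k) *\<^sub>R matrix_power (- M) k)) *v y0)"
    by (intro vec_bigo_bounded_linear[OF linear_linear[THEN iffD2, OF eval_linear]] matrix_exp_expansion F)
  have N2: "vec_bigo F 5 (\<lambda>h. h ^ 1 *\<^sub>R (b1 *\<^sub>R (g (Y1 h) - slope_poly c1 e1 \<alpha>1 \<beta>1 h)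
      + b2 *\<^sub>R (g (Y2 h) - slope_poly c2 e2 \<alpha>2 \<beta>2 h)))"
    unfolding five by (intro vec_bigo_power_scaleR vec_bigo_add vec_bigo_scaleR stages)
  have N3: "vec_bigo F 5 (\<lambda>h. h ^ 1 *\<^sub>R (M *v (b1 *\<^sub>R (Y1 h - y0 - stage_poly c1 e1 \<alpha>1 \<beta>1 h)
      + b2 *\<^sub>R (Y2 h - y0 - stage_poly c2 e2 \<alpha>2 \<beta>2 h))))"
    unfolding five by (intro vec_bigo_power_scaleR vec_bigo_bounded_linear[OF matrix_vector_mul_bounded_linear]
        vec_bigo_add vec_bigo_scaleR stages)
  have "vec_bigo F 5 (\<lambda>h. ((matrix_exp (h *\<^sub>R (- M))
      - (\<Sum>k<5. h ^ k *\<^sub>R (1 / fact k) *\<^sub>R matrix_power (- M) k)) *v y0)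
      + h ^ 1 *\<^sub>R (b1 *\<^sub>R (g (Y1 h) - slope_poly c1 e1 \<alpha>1 \<beta>1 h)
      + b2 *\<^sub>R (g (Y2 h) - slope_poly c2 e2 \<alpha>2 \<beta>2 h))
      + h ^ 1 *\<^sub>R (M *v (b1 *\<^sub>R (Y1 h - y0 - stage_poly c1 e1 \<alpha>1 \<beta>1 h)
      + b2 *\<^sub>R (Y2 h - y0 - stage_poly c2 e2 \<alpha>2 \<beta>2 h))))"
    by (rule vec_bigo_add[OF vec_bigo_add[OF N1 N2] N3])
  \<comment> \<open>The three errors add up to the full error. Replacing \<open>g\<close> by
    \<open>f - M\<close> makes the terms in \<open>M *v Y1 h\<close> and \<open>M *v Y2 h\<close>
    cancel, \<open>b1 + b2 = 1\<close> merges the copies of \<open>y0\<close>, and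
    \<open>stage_sum\<close>, \<open>slope_sum\<close> and \<open>cancel\<close> evaluate the
    polynomial part.\<close>
  moreover have "((matrix_exp (h *\<^sub>R (- M))
      - (\<Sum>k<5. h ^ k *\<^sub>R (1 / fact k) *\<^sub>R matrix_power (- M) k)) *v y0)
      + h ^ 1 *\<^sub>R (b1 *\<^sub>R (g (Y1 h) - slope_poly c1 e1 \<alpha>1 \<beta>1 h)
      + b2 *\<^sub>R (g (Y2 h) - slope_poly c2 e2 \<alpha>2 \<beta>2 h))
      + h ^ 1 *\<^sub>R (M *v (b1 *\<^sub>R (Y1 h - y0 - stage_poly c1 e1 \<alpha>1 \<beta>1 h)
      + b2 *\<^sub>R (Y2 h - y0 - stage_poly c2 e2 \<alpha>2 \<beta>2 h)))
      = mverk_update M f y0 b1 b2 Y1 Y2 h - (\<Sum>k\<le>4. h ^ k *\<^sub>R c k)" (is "?lhs h = ?rhs h") for h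
  proof -
    let ?s1 = "stage_poly c1 e1 \<alpha>1 \<beta>1 h" and ?s2 = "stage_poly c2 e2 \<alpha>2 \<beta>2 h"
    let ?q1 = "slope_poly c1 e1 \<alpha>1 \<beta>1 h" and ?q2 = "slope_poly c2 e2 \<alpha>2 \<beta>2 h"
    let ?E = "\<Sum>k<5. h ^ k *\<^sub>R (1 / fact k) *\<^sub>R (matrix_power (- M) k *v y0)"
    have E: "(\<Sum>k<5. h ^ k *\<^sub>R (1 / fact k) *\<^sub>R matrix_power (- M) k) *v y0 = ?E"
      by (simp only: linear_sum[OF eval_linear] linear_scale[OF eval_linear])
    have f_eq: "f v = g v + M *v v" for v by (simp add: g_def)
    have b: "b1 *\<^sub>R v + b2 *\<^sub>R v = v" for v :: "real^'m"
      using assms(11) by (simp flip: scaleR_add_left)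
    have "?lhs h = matrix_exp (- (h *\<^sub>R M)) *v y0 + h *\<^sub>R (b1 *\<^sub>R f (Y1 h) + b2 *\<^sub>R f (Y2 h))
        - ?E - h *\<^sub>R (b1 *\<^sub>R ?q1 + b2 *\<^sub>R ?q2) - h *\<^sub>R (M *v ((b1 *\<^sub>R y0 + b2 *\<^sub>R y0) + (b1 *\<^sub>R ?s1 + b2 *\<^sub>R ?s2)))"
      unfolding matrix_vector_mult_diff_rdistrib E by (simp add: f_eq algebra_simps)
    also have "\<dots> = ?rhs h"
      unfolding b stage_sum slope_sum c mverk_update_def using cancel[of h]
      by (simp add: algebra_simps)
    finally show ?thesis .
  qed
  ultimately have numerical: "vec_bigo F 5 (\<lambda>h. mverk_update M f y0 b1 b2 Y1 Y2 h - (\<Sum>k\<le>4. h ^ k *\<^sub>R c k))"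
    by simp
  show ?thesis
    unfolding has_order_def F_def[symmetric]
    using exact numerical by (intro exI[of _ c]) (simp add: c vec_bigo_def)
qed

end
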